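(* Assume that $\mathbb{K}$ is a real closed field. Let $M=S(M)+N(M)\in M_n(\mathbb{K})$ be a matrix with its additive Jordan-Chevalley decomposition, with the notation of the context. a) If $S(M)\neq0$, the Frobenius decomposition of $S(M)$ is $$S(M)=\sum_{h=1}^{s_1}\big[\lambda_{h1}C_{h1}(M)+\overline{\lambda_{h1}}\,C_{h2}(M)\big]+\sum_{i=s_1+1}^{s_1+s_2}\gamma_iC_{i1}(M)-\sum_{i=s_1+s_2+1}^{r'}\gamma_iC_{i1}(M),$$ where the $\gamma_i$ are strictly positive elements of $\mathbb{K}$ for every $i=s_1+1,\dots,r'$, the $\lambda_{h1}$ are in $\overline{\mathbb{K}}\setminus\mathbb{K}$ and $C_{h2}(M)=\overline{C_{h1}(M)}$ for every $h=1,\dots,s_1$. b) Moreover, if $M\in GL_n(\mathbb{K})$, then there is a unique way to write $M=\Delta\Sigma U$ as product of three mutually commuting matrices with coefficients in $\mathbb{K}$, with $\Delta$ diagonalizable over $\mathbb{K}$ with strictly positive eigenvalues, $\Sigma$ semisimple with eigenvalues of norm $1$, and $U$ unipotent. In particular we have $$\Delta=\sum_{h=1}^{s_1}N_{\mathbb{K}}(\lambda_{h1})\,[C_{h1}(M)+C_{h2}(M)]+\sum_{i=s_1+1}^{r'}\gamma_iC_{i1}(M),$$ $$\Sigma=\sum_{h=1}^{s_1}\Big[\frac{\lambda_{h1}}{N_{\mathbb{K}}(\lambda_{h1})}C_{h1}(M)+\frac{\overline{\lambda_{h1}}}{N_{\mathbb{K}}(\lambda_{h1})}C_{h2}(M)\Big]+\sum_{i=s_1+1}^{s_1+s_2}C_{i1}(M)-\sum_{i=s_1+s_2+1}^{r'}C_{i1}(M)$$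 (hence $S(M)=\Delta\Sigma$) and $U=I_n+S(M)^{-1}N(M)$. The matrices $\Delta$, $\Sigma$ and $U$ are polynomial functions of $M$.
   Context: $\mathbb{K}$ real closed: $\overline{\mathbb{K}}=\mathbb{K}(\sqrt{-1})$ is its algebraic closure, $\mathbb{K}$ has its unique field ordering, the conjugate of $\lambda=a+b\sqrt{-1}$ ($a,b\in\mathbb{K}$) is $\overline\lambda=a-b\sqrt{-1}$ (applied entrywise to matrices), and the $\mathbb{K}$-norm $N_{\mathbb{K}}(\lambda)$ is the unique non-negative square root of $a^2+b^2$ in $\mathbb{K}$; "norm" of an eigenvalue means $\mathbb{K}$-norm. A matrix is semisimple if it is diagonalizable over $\overline{\mathbb{K}}$. $S(M)$ and $N(M)$ are the unique commuting semisimple and nilpotent matrices over $\overline{\mathbb{K}}$ with $M=S(M)+N(M)$ (additive Jordan-Chevalley decomposition). A Frobenius decomposition of a matrix $A$ is a decomposition $A=\sum_{i=1}^p\lambda_iA_i$ ($p\ge1$) with $A_i\in M_n(\overline{\mathbb{K}})\setminus\{0\}$, $A_iA_j=\delta_{ij}A_i$ for all $i,j$, and $\lambda_i\in\overline{\mathbb{K}}\setminus\{0\}$ pairwise distinct; it is unique up to order when it exists. Let $m(X)=m_1(X)^{\mu_1}\cdots m_r(X)^{\mu_r}$ be the minimal polynomial of $M$ over $\mathbb{K}$, with $\mu_i>0$ and $m_1,\dots,m_r$ mutually distinct monic irreducible polynomials in $\mathbb{K}[X]$ (hence of degree at most $2$). If $0$ is an eigenvalue of $M$, then $m_r(X)=X$.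 Put $r'=r$ if $M$ is nonsingular and $r'=r-1$ otherwise. The factors are ordered so that: for $1\le h\le s_1$, $m_h$ has degree $2$, with distinct roots $\lambda_{h1}$ and $\lambda_{h2}=\overline{\lambda_{h1}}$ in $\overline{\mathbb{K}}\setminus\mathbb{K}$; for $s_1<i\le s_1+s_2$, $m_i$ has degree $1$ with root $\lambda_{i1}=\gamma_i>0$; for $s_1+s_2<i\le r'$, $m_i$ has degree $1$ with root $\lambda_{i1}=-\gamma_i<0$. Let $\rho_i=\deg m_i$ be the number of roots $\lambda_{ij}$ of $m_i$; then $m(X)=\prod_{i,j}(X-\lambda_{ij})^{\mu_i}$. Put $G_{ij}(X)=m(X)/(X-\lambda_{ij})^{\mu_i}$. There is a unique family of polynomials $B_{ij}(X)\in\mathbb{K}(\lambda_{i1},\dots,\lambda_{i\rho_i})[X]$ with $\deg B_{ij}<\mu_i$ and $\sum_{i=1}^r\sum_{j=1}^{\rho_i}B_{ij}(X)G_{ij}(X)=1$; put $C_{ij}(X)=B_{ij}(X)G_{ij}(X)$. *)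

theory Defs
  imports
    "HOL-Computational_Algebra.Polynomial_Factorial"
    "Jordan_Normal_Form.Char_Poly"
    "Jordan_Normal_Form.Gauss_Jordan_Elimination"
    "Jordan_Normal_Form.Jordan_Normal_Form_Existence"
begin

section \<open>Real closed fields\<close>

text \<open>
  \<open>'a adjoin_i\<close> is the field \<open>K(\<surd>-1)\<close> over an ordered field \<open>K = 'a\<close>; the element
  \<open>Adj a b\<close> stands for \<open>a + b \<surd>-1\<close>.
\<close>

datatype 'a adjoin_i = Adj (re_part: 'a) (im_part: 'a)

lemma adjoin_i_eq_iff: "x = y \<longleftrightarrow> re_part x = re_part y \<and> im_part x = im_part y"
  by (auto intro: adjoin_i.expand)

instantiation adjoin_i :: (linordered_field) field
begin

definition "0 = Adj 0 0"
definition "1 = Adj 1 0"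
definition "x + y = Adj (re_part x + re_part y) (im_part x + im_part y)"
definition "- x = Adj (- re_part x) (- im_part x)"
definition "x - y = Adj (re_part x - re_part y) (im_part x - im_part y)"
definition "x * y = Adj (re_part x * re_part y - im_part x * im_part y)
                        (re_part x * im_part y + im_part x * re_part y)"
definition "inverse x = Adj (re_part x / ((re_part x)\<^sup>2 + (im_part x)\<^sup>2))
                            (- im_part x / ((re_part x)\<^sup>2 + (im_part x)\<^sup>2))"
definition "x div y = x * inverse y" for x y :: "'a adjoin_i"

lemmas adjoin_i_defs = zero_adjoin_i_def one_adjoin_i_def plus_adjoin_i_def uminus_adjoin_i_def
  minus_adjoin_i_def times_adjoin_i_def inverse_adjoin_i_def divide_adjoin_i_def

instance
proof
  fix x y z :: "'a adjoin_i"
  show "inverse x * x = 1" if "x \<noteq> 0"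
  proof -
    have "(re_part x)\<^sup>2 + (im_part x)\<^sup>2 \<noteq> 0"
      using that by (auto simp: adjoin_i_eq_iff adjoin_i_defs sum_power2_eq_zero_iff)
    then show ?thesis
      by (simp add: adjoin_i_eq_iff adjoin_i_defs power2_eq_square add_divide_distrib [symmetric])
  qed
qed (simp_all add: adjoin_i_eq_iff adjoin_i_defs algebra_simps)

end

definition of_base :: "'a::linordered_field \<Rightarrow> 'a adjoin_i" where
  "of_base a = Adj a 0"

definition conj_i :: "'a::linordered_field adjoin_i \<Rightarrow> 'a adjoin_i" where
  "conj_i z = Adj (re_part z) (- im_part z)"

text \<open>
  A field \<open>K\<close> is real closed iff \<open>-1\<close> is not a square in \<open>K\<close> and \<open>K(\<surd>-1)\<close> is algebraically
  closed, i.e. \<open>K(\<surd>-1)\<close> is a quadratic extension that is an algebraic closure of \<open>K\<close>.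
  Here \<open>-1\<close> is a non-square because \<open>K\<close> is ordered, and the given order is the unique field
  ordering of \<open>K\<close>, because under this assumption every nonnegative element is a square.
\<close>

definition real_closed :: "'a::linordered_field itself \<Rightarrow> bool" where
  "real_closed _ \<longleftrightarrow> (\<forall>p :: 'a adjoin_i poly. 0 < degree p \<longrightarrow> (\<exists>z. poly p z = 0))"

definition norm_K :: "'a::linordered_field adjoin_i \<Rightarrow> 'a" where
  "norm_K z = (THE y. 0 \<le> y \<and> y\<^sup>2 = (re_part z)\<^sup>2 + (im_part z)\<^sup>2)"

text \<open>The subfield \<open>K(L)\<close> of \<open>K(\<surd>-1)\<close> generated by \<open>K\<close> and the set \<open>L\<close>.\<close>

definition adjoin :: "'a::linordered_field adjoin_i set \<Rightarrow> 'a adjoin_i set" where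
  "adjoin L = \<Inter> {F. range of_base \<subseteq> F \<and> L \<subseteq> F \<and>
     (\<forall>x\<in>F. \<forall>y\<in>F. x + y \<in> F \<and> x - y \<in> F \<and> x * y \<in> F \<and> inverse x \<in> F)}"

abbreviation ext_poly :: "'a::linordered_field poly \<Rightarrow> 'a adjoin_i poly" where
  "ext_poly \<equiv> map_poly of_base"

abbreviation ext_mat :: "'a::linordered_field mat \<Rightarrow> 'a adjoin_i mat" where
  "ext_mat \<equiv> map_mat of_base"


section \<open>Matrices\<close>

definition mat_sum :: "nat \<Rightarrow> ('i \<Rightarrow> 'k::comm_monoid_add mat) \<Rightarrow> 'i set \<Rightarrow> 'k mat" where
  "mat_sum n F I = mat n n (\<lambda>(a, b). \<Sum>i\<in>I. F i $$ (a, b))"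

definition poly_mat :: "'k::comm_ring_1 poly \<Rightarrow> 'k mat \<Rightarrow> 'k mat" where
  "poly_mat p A = mat_sum (dim_row A) (\<lambda>k. coeff p k \<cdot>\<^sub>m (A ^\<^sub>m k)) {..degree p}"

definition is_min_poly :: "'k::field mat \<Rightarrow> 'k poly \<Rightarrow> bool" where
  "is_min_poly A p \<longleftrightarrow> lead_coeff p = 1 \<and> poly_mat p A = 0\<^sub>m (dim_row A) (dim_row A) \<and>
     (\<forall>q. q \<noteq> 0 \<and> poly_mat q A = 0\<^sub>m (dim_row A) (dim_row A) \<longrightarrow> degree p \<le> degree q)"

text \<open>
  Diagonalizability is over the coefficient field of the matrix; a matrix \<open>A\<close> over \<open>K\<close> is
  semisimple iff \<open>ext_mat A\<close> is diagonalizable.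
\<close>

definition diagonalizable :: "'k::field mat \<Rightarrow> bool" where
  "diagonalizable A \<longleftrightarrow> (\<exists>D. similar_mat A D \<and> diagonal_mat D)"

definition nilpotent_mat :: "'k::field mat \<Rightarrow> bool" where
  "nilpotent_mat A \<longleftrightarrow> (\<exists>k. A ^\<^sub>m k = 0\<^sub>m (dim_row A) (dim_row A))"

definition unipotent_mat :: "'k::field mat \<Rightarrow> bool" where
  "unipotent_mat A \<longleftrightarrow> nilpotent_mat (A - 1\<^sub>m (dim_row A))"

definition jordan_chevalley :: "'k::field mat \<Rightarrow> 'k mat \<Rightarrow> 'k mat \<Rightarrow> bool" where
  "jordan_chevalley A S N \<longleftrightarrow>
     S \<in> carrier_mat (dim_row A) (dim_row A) \<and> N \<in> carrier_mat (dim_row A) (dim_row A) \<and>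
     diagonalizable S \<and> nilpotent_mat N \<and> S * N = N * S \<and> A = S + N"

definition ss_part :: "'a::linordered_field mat \<Rightarrow> 'a adjoin_i mat" where
  "ss_part M = (THE S. \<exists>N. jordan_chevalley (ext_mat M) S N)"

definition nil_part :: "'a::linordered_field mat \<Rightarrow> 'a adjoin_i mat" where
  "nil_part M = (THE N. \<exists>S. jordan_chevalley (ext_mat M) S N)"

definition frobenius_decomposition ::
  "nat \<Rightarrow> 'k::field mat \<Rightarrow> 'i set \<Rightarrow> ('i \<Rightarrow> 'k) \<Rightarrow> ('i \<Rightarrow> 'k mat) \<Rightarrow> bool" where
  "frobenius_decomposition n A I l F \<longleftrightarrow>
     finite I \<and> I \<noteq> {} \<and>
     (\<forall>i\<in>I. F i \<in> carrier_mat n n \<and> F i \<noteq> 0\<^sub>m n n) \<and>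
     (\<forall>i\<in>I. \<forall>j\<in>I. F i * F j = (if i = j then F i else 0\<^sub>m n n)) \<and>
     (\<forall>i\<in>I. l i \<noteq> 0) \<and> inj_on l I \<and>
     A = mat_sum n (\<lambda>i. l i \<cdot>\<^sub>m F i) I"

definition DSU_decomposition ::
  "nat \<Rightarrow> 'a::linordered_field mat \<Rightarrow> 'a mat \<Rightarrow> 'a mat \<Rightarrow> 'a mat \<Rightarrow> bool" where
  "DSU_decomposition n M D T U \<longleftrightarrow>
     D \<in> carrier_mat n n \<and> T \<in> carrier_mat n n \<and> U \<in> carrier_mat n n \<and>
     M = D * T * U \<and> D * T = T * D \<and> D * U = U * D \<and> T * U = U * T \<and>
     diagonalizable D \<and> (\<forall>x. eigenvalue D x \<longrightarrow> 0 < x) \<and>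
     diagonalizable (ext_mat T) \<and> (\<forall>z. eigenvalue (ext_mat T) z \<longrightarrow> norm_K z = 1) \<and>
     unipotent_mat U"

end

theory Submission
  imports Defs "Jordan_Normal_Form.DL_Rank"
begin

text \<open>
  Over \<open>K(\<surd>-1)\<close> the minimal polynomial of \<open>M\<close> is a product of pairwise coprime powers
  \<open>(X - \<lambda>)^\<mu>\<close>. The polynomials \<open>C\<close> of the theorem satisfy the Chinese remainder
  conditions \<open>C \<equiv> 1\<close> modulo their own power and \<open>C \<equiv> 0\<close> modulo all others. A polynomial that
  is divisible by every power vanishes at \<open>M\<close>, so each identity between polynomials in \<open>M\<close> may be
  tested modulo one power at a time, where \<open>C\<close> is a constant. This makes
  \<open>g \<mapsto> \<Sum> g(\<lambda>) C(M)\<close> a functional calculus: it is multiplicative in \<open>g\<close>, all its values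
  are diagonalizable and are polynomials in \<open>M\<close>, and a function \<open>g\<close> that commutes with
  conjugation is sent to a matrix over \<open>K\<close>.

  Applied to the identity, the calculus gives a diagonalizable matrix \<open>S = s(M)\<close> for a polynomial \<open>s\<close>
  which is congruent to \<open>X\<close> modulo every \<open>X - \<lambda>\<close>; hence \<open>M - S\<close> is nilpotent and \<open>S\<close> is the semisimple part
  (\<open>jordan_chevalley_iff\<close>). Two commuting diagonalizable matrices have a common eigenbasis
  (\<open>simultaneous_diagonalization\<close>), which gives the uniqueness of the Jordan-Chevalley
  decomposition (\<open>jordan_chevalley_unique\<close>).

  For invertible \<open>M\<close>, the factors \<open>\<Delta>\<close> and \<open>\<Sigma>\<close> are the values of the calculus at
  \<open>|z|\<close> and \<open>z / |z|\<close>, and \<open>U = S\<^sup>-\<^sup>1 M\<close> (\<open>DSU_exists\<close>). Conversely, let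
  \<open>M = \<Delta> \<Sigma> U\<close> be any decomposition. Then \<open>\<Delta> \<Sigma>\<close> is diagonalizable and
  \<open>\<Delta> \<Sigma> (U - 1)\<close> is nilpotent, so \<open>\<Delta> \<Sigma> = S\<close> by uniqueness. In a common eigenbasis
  of \<open>\<Delta>\<close> and \<open>\<Sigma>\<close> the eigenvalues are some \<open>a > 0\<close> and some \<open>b\<close> of norm one, and
  both are recovered from \<open>a b\<close>, the eigenvalue of \<open>S\<close>, as \<open>|a b|\<close> and \<open>a b / |a b|\<close>
  (\<open>DSU_unique\<close>).
\<close>

section \<open>Sums of matrices and polynomials in a matrix\<close>

lemma mat_sum_carrier [simp]: "mat_sum n F I \<in> carrier_mat n n"
  by (simp add: mat_sum_def)

lemma dim_mat_sum [simp]: "dim_row (mat_sum n F I) = n" "dim_col (mat_sum n F I) = n"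
  by (simp_all add: mat_sum_def)

lemma index_mat_sum [simp]:
  "a < n \<Longrightarrow> b < n \<Longrightarrow> mat_sum n F I $$ (a, b) = (\<Sum>i\<in>I. F i $$ (a, b))"
  by (simp add: mat_sum_def)

lemma mat_sum_empty [simp]: "mat_sum n F {} = 0\<^sub>m n n"
  by (rule eq_matI) auto

lemma mat_sum_cong: "(\<And>i. i \<in> I \<Longrightarrow> F i = H i) \<Longrightarrow> mat_sum n F I = mat_sum n H I"
  by (simp add: mat_sum_def)

lemma mat_sum_insert:
  "finite I \<Longrightarrow> i \<notin> I \<Longrightarrow> F i \<in> carrier_mat n n \<Longrightarrow>
   mat_sum n F (insert i I) = F i + mat_sum n F I"
  by (rule eq_matI) auto

lemma mult_mat_sum:
  fixes A :: "'k::semiring_0 mat"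
  assumes "A \<in> carrier_mat n n" "\<And>i. i \<in> I \<Longrightarrow> F i \<in> carrier_mat n n"
  shows "A * mat_sum n F I = mat_sum n (\<lambda>i. A * F i) I"
proof (rule eq_matI)
  fix a b assume "a < dim_row (mat_sum n (\<lambda>i. A * F i) I)" "b < dim_col (mat_sum n (\<lambda>i. A * F i) I)"
  then have ab: "a < n" "b < n" by auto
  have "(A * mat_sum n F I) $$ (a, b) = (\<Sum>k<n. A $$ (a, k) * (\<Sum>i\<in>I. F i $$ (k, b)))"
    using assms ab by (simp add: scalar_prod_def atLeast0LessThan)
  also have "\<dots> = (\<Sum>i\<in>I. \<Sum>k<n. A $$ (a, k) * F i $$ (k, b))"
    by (simp add: sum_distrib_left) (rule sum.swap)
  also have "\<dots> = (\<Sum>i\<in>I. (A * F i) $$ (a, b))"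
  proof (rule sum.cong)
    fix i assume "i \<in> I"
    then have "F i \<in> carrier_mat n n" using assms by auto
    then show "(\<Sum>k<n. A $$ (a, k) * F i $$ (k, b)) = (A * F i) $$ (a, b)"
      using assms(1) ab by (simp add: scalar_prod_def atLeast0LessThan)
  qed simp
  finally show "(A * mat_sum n F I) $$ (a, b) = mat_sum n (\<lambda>i. A * F i) I $$ (a, b)"
    using ab by simp
qed (use assms in auto)

lemma mat_sum_mult:
  fixes A :: "'k::semiring_0 mat"
  assumes "A \<in> carrier_mat n n" "\<And>i. i \<in> I \<Longrightarrow> F i \<in> carrier_mat n n"
  shows "mat_sum n F I * A = mat_sum n (\<lambda>i. F i * A) I"
proof (rule eq_matI)
  fix a b assume "a < dim_row (mat_sum n (\<lambda>i. F i * A) I)" "b < dim_col (mat_sum n (\<lambda>i. F i * A) I)"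
  then have ab: "a < n" "b < n" by auto
  have "(mat_sum n F I * A) $$ (a, b) = (\<Sum>k<n. (\<Sum>i\<in>I. F i $$ (a, k)) * A $$ (k, b))"
    using assms ab by (simp add: scalar_prod_def atLeast0LessThan)
  also have "\<dots> = (\<Sum>i\<in>I. \<Sum>k<n. F i $$ (a, k) * A $$ (k, b))"
    by (simp add: sum_distrib_right) (rule sum.swap)
  also have "\<dots> = (\<Sum>i\<in>I. (F i * A) $$ (a, b))"
  proof (rule sum.cong)
    fix i assume "i \<in> I"
    then have "F i \<in> carrier_mat n n" using assms by auto
    then show "(\<Sum>k<n. F i $$ (a, k) * A $$ (k, b)) = (F i * A) $$ (a, b)"
      using assms(1) ab by (simp add: scalar_prod_def atLeast0LessThan)
  qed simp
  finally show "(mat_sum n F I * A) $$ (a, b) = mat_sum n (\<lambda>i. F i * A) I $$ (a, b)"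
    using ab by simp
qed (use assms in auto)

text \<open>
  The rules for products in \<open>carrier_mat\<close> leave the inner dimension undetermined, which blocks
  conditional rewriting. For square matrices of one fixed size \<open>n\<close> this obstacle disappears.
\<close>

lemma square_mult_carrier [simp]:
  "A \<in> carrier_mat n n \<Longrightarrow> B \<in> carrier_mat n n \<Longrightarrow> A * B \<in> carrier_mat n n"
  by simp

lemma square_mat_distribs:
  fixes A B D :: "'k::comm_ring_1 mat"
  assumes "A \<in> carrier_mat n n" "B \<in> carrier_mat n n" "D \<in> carrier_mat n n"
  shows "A * B * D = A * (B * D)" "(A + B) * D = A * D + B * D" "A * (B + D) = A * B + A * D"
    "(A - B) * D = A * D - B * D" "A * (B - D) = A * B - A * D"
  using assms
  by (simp_all add: assoc_mult_mat[of _ n n _ n _ n] add_mult_distrib_mat[of _ n n _ _ n]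
      mult_add_distrib_mat[of _ n n _ n] minus_mult_distrib_mat[of _ n n _ _ n]
      mult_minus_distrib_mat[of _ n n _ n])

lemma square_mat_scalars:
  fixes A B :: "'k::comm_ring_1 mat"
  assumes "A \<in> carrier_mat n n" "B \<in> carrier_mat n n"
  shows "(c \<cdot>\<^sub>m A) * B = c \<cdot>\<^sub>m (A * B)" "A * (c \<cdot>\<^sub>m B) = c \<cdot>\<^sub>m (A * B)"
  using assms by (simp_all add: mult_smult_assoc_mat[of _ n n _ n] mult_smult_distrib[of _ n n _ n])

lemmas square_mat_algebra = square_mat_distribs square_mat_scalars

lemma poly_mat_carrier [simp]: "A \<in> carrier_mat n n \<Longrightarrow> poly_mat p A \<in> carrier_mat n n"
  by (auto simp: poly_mat_def)

lemma poly_mat_dim [simp]: "dim_row (poly_mat p A) = dim_row A" "dim_col (poly_mat p A) = dim_row A"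
  by (simp_all add: poly_mat_def)

text \<open>
  Summing up to any bound \<open>N\<close> above the degree lets polynomials of different degrees be
  compared entry by entry.
\<close>

lemma poly_mat_index:
  assumes A: "A \<in> carrier_mat n n" and ab: "a < n" "b < n" and N: "degree p \<le> N"
  shows "poly_mat p A $$ (a, b) = (\<Sum>k\<le>N. coeff p k * (A ^\<^sub>m k) $$ (a, b))"
proof -
  have "poly_mat p A $$ (a, b) = (\<Sum>k\<le>degree p. coeff p k * (A ^\<^sub>m k) $$ (a, b))"
    using A ab by (simp add: poly_mat_def)
  also have "\<dots> = (\<Sum>k\<le>N. coeff p k * (A ^\<^sub>m k) $$ (a, b))"
    using N by (intro sum.mono_neutral_left) (auto simp: coeff_eq_0)
  finally show ?thesis .
qed

lemma poly_mat_add: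
  assumes A: "A \<in> carrier_mat n n"
  shows "poly_mat (p + q) A = poly_mat p A + poly_mat q A"
proof (rule eq_matI)
  fix a b
  assume "a < dim_row (poly_mat p A + poly_mat q A)" "b < dim_col (poly_mat p A + poly_mat q A)"
  then have ab: "a < n" "b < n" using A by auto
  define N where "N = max (degree p) (degree q)"
  have "degree (p + q) \<le> N" by (simp add: N_def degree_add_le_max)
  then show "poly_mat (p + q) A $$ (a, b) = (poly_mat p A + poly_mat q A) $$ (a, b)"
    using A ab
    by (simp add: poly_mat_index[OF A ab, of _ N] N_def algebra_simps sum.distrib)
qed (use A in auto)

lemma poly_mat_smult:
  assumes A: "A \<in> carrier_mat n n"
  shows "poly_mat (Polynomial.smult c p) A = c \<cdot>\<^sub>m poly_mat p A"
proof (rule eq_matI)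
  fix a b
  assume "a < dim_row (c \<cdot>\<^sub>m poly_mat p A)" "b < dim_col (c \<cdot>\<^sub>m poly_mat p A)"
  then have ab: "a < n" "b < n" using A by auto
  show "poly_mat (Polynomial.smult c p) A $$ (a, b) = (c \<cdot>\<^sub>m poly_mat p A) $$ (a, b)"
    using A ab
    by (simp add: poly_mat_index[OF A ab, of _ "degree p"] degree_smult_le sum_distrib_left mult.assoc)
qed (use A in auto)

lemma poly_mat_0 [simp]: "A \<in> carrier_mat n n \<Longrightarrow> poly_mat 0 A = 0\<^sub>m n n"
  by (rule eq_matI) (auto simp: poly_mat_index[of A n])

lemma poly_mat_1 [simp]: "A \<in> carrier_mat n n \<Longrightarrow> poly_mat 1 A = 1\<^sub>m n"
  by (rule eq_matI) (auto simp: poly_mat_index[of A n])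

lemma poly_mat_X [simp]:
  assumes A: "A \<in> carrier_mat n n" shows "poly_mat [:0, 1:] A = A"
  by (rule eq_matI) (use A in \<open>auto simp: poly_mat_index[of A n _ _ _ 1]\<close>)

lemma poly_mat_uminus:
  assumes A: "A \<in> carrier_mat n n" shows "poly_mat (- p) A = - poly_mat p A"
  using poly_mat_smult[OF A, of "-1" p] A by (auto intro!: eq_matI)

lemma poly_mat_diff:
  assumes A: "A \<in> carrier_mat n n" shows "poly_mat (p - q) A = poly_mat p A - poly_mat q A"
  using poly_mat_add[OF A, of p "- q"] poly_mat_uminus[OF A, of q] A by (auto intro!: eq_matI)

lemma poly_mat_sum:
  assumes A: "A \<in> carrier_mat n n"
  shows "poly_mat (\<Sum>i\<in>I. f i) A = mat_sum n (\<lambda>i. poly_mat (f i) A) I"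
proof (induction I rule: infinite_finite_induct)
  case (infinite I)
  then show ?case using A by (auto intro!: eq_matI)
next
  case empty
  then show ?case using A by simp
next
  case (insert i I)
  then show ?case using A by (simp add: mat_sum_insert poly_mat_add[OF A])
qed

lemma poly_mat_mult_X:
  assumes A: "A \<in> carrier_mat n n"
  shows "poly_mat (pCons 0 p) A = poly_mat p A * A"
proof -
  have "poly_mat p A * A = mat_sum n (\<lambda>k. (coeff p k \<cdot>\<^sub>m A ^\<^sub>m k) * A) {..degree p}"
    using A by (simp add: poly_mat_def mat_sum_mult)
  also have "\<dots> = mat_sum n (\<lambda>k. coeff p k \<cdot>\<^sub>m A ^\<^sub>m Suc k) {..degree p}"
    by (rule mat_sum_cong) (use A in \<open>simp add: square_mat_algebra[where n = n]\<close>)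
  also have "\<dots> = poly_mat (pCons 0 p) A"
  proof (rule eq_matI)
    fix a b assume "a < dim_row (poly_mat (pCons 0 p) A)" "b < dim_col (poly_mat (pCons 0 p) A)"
    then have ab: "a < n" "b < n" using A by auto
    have "poly_mat (pCons 0 p) A $$ (a, b) =
        (\<Sum>k\<le>Suc (degree p). coeff (pCons 0 p) k * (A ^\<^sub>m k) $$ (a, b))"
      by (rule poly_mat_index[OF A ab]) (simp add: degree_pCons_le)
    then show "mat_sum n (\<lambda>k. coeff p k \<cdot>\<^sub>m A ^\<^sub>m Suc k) {..degree p} $$ (a, b) =
        poly_mat (pCons 0 p) A $$ (a, b)"
      using A ab by (simp add: sum.atMost_Suc_shift del: sum.atMost_Suc)
  qed (use A in auto)
  finally show ?thesis ..
qed

lemma poly_mat_mult: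
  assumes A: "A \<in> carrier_mat n n"
  shows "poly_mat (p * q) A = poly_mat p A * poly_mat q A"
proof (induction q)
  case 0
  then show ?case using A by simp
next
  case (pCons c q)
  have c: "pCons c q = Polynomial.smult c 1 + pCons 0 q"
    by (simp add: one_pCons)
  have "poly_mat (p * pCons c q) A = poly_mat (Polynomial.smult c p + pCons 0 (p * q)) A"
    by simp
  also have "\<dots> = c \<cdot>\<^sub>m poly_mat p A + poly_mat p A * (poly_mat q A * A)"
    using pCons(2) A
    by (simp add: poly_mat_add[OF A] poly_mat_smult[OF A] poly_mat_mult_X[OF A]
        square_mat_algebra[where n = n])
  also have "\<dots> = poly_mat p A * (c \<cdot>\<^sub>m 1\<^sub>m n + poly_mat q A * A)"
    using A by (simp add: square_mat_algebra[where n = n])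
  also have "c \<cdot>\<^sub>m 1\<^sub>m n + poly_mat q A * A = poly_mat (pCons c q) A"
    unfolding c using A by (simp only: poly_mat_add[OF A] poly_mat_smult[OF A] poly_mat_mult_X[OF A] poly_mat_1[OF A])
  finally show ?case .
qed

lemma poly_mat_commute:
  assumes A: "A \<in> carrier_mat n n"
  shows "poly_mat p A * poly_mat q A = poly_mat q A * poly_mat p A"
  by (simp add: poly_mat_mult[OF A, symmetric] mult.commute)

lemma poly_mat_power:
  assumes A: "A \<in> carrier_mat n n"
  shows "poly_mat (p ^ k) A = poly_mat p A ^\<^sub>m k"
proof (induction k)
  case 0
  then show ?case using A by simp
next
  case (Suc k)
  have "poly_mat (p ^ Suc k) A = poly_mat (p ^ k * p) A" by (simp add: mult.commute)
  then show ?case using Suc by (simp add: poly_mat_mult[OF A])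
qed

text \<open>
  Uniqueness statements need this for matrices \<open>B\<close> that are not polynomials in \<open>A\<close>.
\<close>

lemma poly_mat_commuting:
  assumes A: "A \<in> carrier_mat n n" and B: "B \<in> carrier_mat n n" and AB: "A * B = B * A"
  shows "poly_mat p A * B = B * poly_mat p A"
proof (induction p)
  case 0
  then show ?case using A B by simp
next
  case (pCons c p)
  have c: "pCons c p = Polynomial.smult c 1 + pCons 0 p"
    by (simp add: one_pCons)
  have e: "poly_mat (pCons c p) A = c \<cdot>\<^sub>m 1\<^sub>m n + poly_mat p A * A"
    unfolding c using A by (simp only: poly_mat_add[OF A] poly_mat_smult[OF A] poly_mat_mult_X[OF A] poly_mat_1[OF A])
  have "poly_mat p A * A * B = poly_mat p A * B * A"
    using A B AB by (simp add: square_mat_algebra[where n = n])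
  also have "\<dots> = B * (poly_mat p A * A)"
    using A B pCons(2) by (simp add: square_mat_algebra[where n = n])
  finally show ?case
    unfolding e using A B
    by (simp add: square_mat_algebra[where n = n])
qed

lemma poly_mat_hom:
  assumes h: "comm_ring_hom h" and A: "A \<in> carrier_mat n n"
  shows "map_mat h (poly_mat p A) = poly_mat (map_poly h p) (map_mat h A)"
proof -
  interpret comm_ring_hom h by (rule h)
  have hA: "map_mat h A \<in> carrier_mat n n" using A by simp
  show ?thesis
  proof (rule eq_matI)
    fix a b
    assume "a < dim_row (poly_mat (map_poly h p) (map_mat h A))"
      "b < dim_col (poly_mat (map_poly h p) (map_mat h A))"
    then have ab: "a < n" "b < n" using A by auto
    have "dim_row (A ^\<^sub>m k) = n" "dim_col (A ^\<^sub>m k) = n" for k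
      using A pow_carrier_mat[OF A, of k] by auto
    then have "h ((A ^\<^sub>m k) $$ (a, b)) = (map_mat h A ^\<^sub>m k) $$ (a, b)" for k
      using ab by (simp add: mat_hom_pow[OF A, symmetric])
    then show "map_mat h (poly_mat p A) $$ (a, b) =
        poly_mat (map_poly h p) (map_mat h A) $$ (a, b)"
      using A ab
      by (simp add: poly_mat_index[OF A ab order_refl] hom_sum hom_mult
          poly_mat_index[OF hA ab degree_map_poly_le])
  qed (use A in auto)
qed

section \<open>Common eigenbases\<close>

definition inverse_pair :: "nat \<Rightarrow> 'k::semiring_1 mat \<Rightarrow> 'k mat \<Rightarrow> bool" where
  "inverse_pair n P Q \<longleftrightarrow> P \<in> carrier_mat n n \<and> Q \<in> carrier_mat n n \<and> P * Q = 1\<^sub>m n \<and> Q * P = 1\<^sub>m n"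

lemma dim_mat_diag [simp]: "dim_row (mat_diag n d) = n" "dim_col (mat_diag n d) = n"
  by (simp_all add: mat_diag_def)

lemma inverse_pairD:
  assumes "inverse_pair n P Q"
  shows "P \<in> carrier_mat n n" "Q \<in> carrier_mat n n" "P * Q = 1\<^sub>m n" "Q * P = 1\<^sub>m n"
  using assms by (auto simp: inverse_pair_def)

lemma inverse_pair_cancel:
  fixes P Q :: "'k::comm_ring_1 mat"
  assumes PQ: "inverse_pair n P Q" and X: "X \<in> carrier_mat n n"
  shows "Q * (P * X) = X" "P * (Q * X) = X" "X * P * Q = X" "X * Q * P = X"
proof -
  note c = inverse_pairD[OF PQ]
  show "Q * (P * X) = X" "P * (Q * X) = X"
    using c X square_mat_algebra(1)[of Q n P X] square_mat_algebra(1)[of P n Q X] by simp_all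
  show "X * P * Q = X" "X * Q * P = X"
    using c X square_mat_algebra(1)[of X n Q P] square_mat_algebra(1)[of X n P Q] by simp_all
qed

lemma conjugate_mult:
  fixes P Q :: "'k::comm_ring_1 mat"
  assumes PQ: "inverse_pair n P Q" and X: "X \<in> carrier_mat n n" and Y: "Y \<in> carrier_mat n n"
  shows "(P * X * Q) * (P * Y * Q) = P * (X * Y) * Q"
  using inverse_pairD[OF PQ] X Y
  by (simp add: square_mat_algebra[where n = n] inverse_pair_cancel[OF PQ])

lemma diagonalizable_iff:
  fixes A :: "'k::field mat"
  assumes A: "A \<in> carrier_mat n n"
  shows "diagonalizable A \<longleftrightarrow> (\<exists>P Q d. inverse_pair n P Q \<and> A = P * mat_diag n d * Q)"
proof
  assume "diagonalizable A"
  then obtain D P Q where D: "similar_mat_wit A D P Q" and diag: "diagonal_mat D"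
    by (auto simp: diagonalizable_def similar_mat_def)
  note w = similar_mat_witD2[OF A D]
  have "D = mat_diag n (\<lambda>i. D $$ (i, i))"
    using w diag by (auto simp: mat_diag_def diagonal_mat_def)
  then have "A = P * mat_diag n (\<lambda>i. D $$ (i, i)) * Q" using w by simp
  moreover have "inverse_pair n P Q" using w by (simp add: inverse_pair_def)
  ultimately show "\<exists>P Q d. inverse_pair n P Q \<and> A = P * mat_diag n d * Q" by blast
next
  assume "\<exists>P Q d. inverse_pair n P Q \<and> A = P * mat_diag n d * Q"
  then obtain P Q d where PQ: "inverse_pair n P Q" and e: "A = P * mat_diag n d * Q" by blast
  have "similar_mat A (mat_diag n d)"
    by (rule similar_matI[of _ _ P Q n]) (use inverse_pairD[OF PQ] A e in auto)
  then show "diagonalizable A"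
    unfolding diagonalizable_def by (auto simp: diagonal_mat_def mat_diag_def)
qed

lemma eigenvalue_diagonalized:
  fixes A :: "'k::field mat"
  assumes PQ: "inverse_pair n P Q" and e: "A = P * mat_diag n d * Q"
  shows "eigenvalue A x \<longleftrightarrow> x \<in> d ` {..<n}"
proof -
  note c = inverse_pairD[OF PQ]
  have A: "A \<in> carrier_mat n n" using c e by auto
  have "similar_mat A (mat_diag n d)"
    by (rule similar_matI[of _ _ P Q n]) (use c A e in auto)
  then have "char_poly A = char_poly (mat_diag n d)" by (rule char_poly_similar)
  also have "\<dots> = (\<Prod>a\<leftarrow>diag_mat (mat_diag n d). [:- a, 1:])"
    by (rule char_poly_upper_triangular[of _ n]) (auto simp: mat_diag_def)
  finally show ?thesis
    by (auto simp: eigenvalue_root_char_poly[OF A] poly_prod_list prod_list_zero_iff diag_mat_def mat_diag_def)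
qed

text \<open>
  If \<open>\<Sum> R\<^sub>i = 1\<close>, the vectors \<open>R\<^sub>i e\<^sub>j\<close> span the whole space, because
  \<open>e\<^sub>j = \<Sum> R\<^sub>i e\<^sub>j\<close>; so they contain a basis. As each of them lies in the image of some
  \<open>R\<^sub>i\<close>, that one basis diagonalizes every matrix that acts on each of these images as a scalar.
  The base change is chosen before \<open>A\<close>, which is what makes simultaneous diagonalization possible.
\<close>

lemma diagonalize_resolution:
  fixes R :: "'i \<Rightarrow> 'k::field mat"
  assumes fin: "finite I" and R: "\<And>i. i \<in> I \<Longrightarrow> R i \<in> carrier_mat n n"
    and sum: "mat_sum n R I = 1\<^sub>m n"
  obtains P Q \<kappa> where "inverse_pair n P Q" "\<And>j. j < n \<Longrightarrow> \<kappa> j \<in> I"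
    "\<And>A c. A \<in> carrier_mat n n \<Longrightarrow> (\<And>i. i \<in> I \<Longrightarrow> A * R i = c i \<cdot>\<^sub>m R i) \<Longrightarrow>
       A = P * mat_diag n (\<lambda>j. c (\<kappa> j)) * Q"
proof -
  interpret V: vec_space "TYPE('k)" n .
  define T where "T = (\<lambda>(i, j). R i *\<^sub>v unit_vec n j) ` (I \<times> {..<n})"
  have T: "T \<subseteq> carrier_vec n" using R by (auto simp: T_def intro!: mult_mat_vec_carrier[of _ n n])
  have finT: "finite T" using fin by (simp add: T_def)
  have "unit_vec n j \<in> V.span T" if j: "j < n" for j
  proof -
    have "mat_sum n R J *\<^sub>v unit_vec n j \<in> V.span T" if "J \<subseteq> I" for J
      using finite_subset[OF that fin] that
    proof (induction J rule: finite_induct)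
      case empty
      have "mat_sum n R {} *\<^sub>v unit_vec n j = 0\<^sub>v n" using j by auto
      moreover have "0\<^sub>v n \<in> V.span T" using V.sumlist_in_span[OF T, of "[]"] by simp
      ultimately show ?case by (simp only:)
    next
      case (insert i J)
      have "R i *\<^sub>v unit_vec n j \<in> V.span T"
        using V.in_own_span[OF T] insert j by (auto simp: T_def)
      moreover have "mat_sum n R (insert i J) *\<^sub>v unit_vec n j =
          R i *\<^sub>v unit_vec n j + mat_sum n R J *\<^sub>v unit_vec n j"
        using insert R by (simp add: mat_sum_insert add_mult_distrib_mat_vec[of _ n n])
      ultimately show ?case using V.span_add1[OF T] insert by auto
    qed
    from this[of I] show ?thesis using sum by simp
  qed
  then have units: "set (unit_vecs n) \<subseteq> V.span T" by (auto simp: unit_vecs_def)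
  have "carrier_vec n \<subseteq> V.span T"
    using V.span_subsetI[OF T units] by (simp only: V.span_unit_vecs_is_carrier)
  then have span: "V.span T = carrier_vec n"
    using V.span_is_subset2[OF T] by (simp add: subset_antisym)
  obtain U where U: "finite U" "maximal U (\<lambda>U. U \<subseteq> T \<and> V.lin_indpt U)"
    using maximal_exists_superset[OF finT, of "\<lambda>U. U \<subseteq> T \<and> V.lin_indpt U" "{}"]
    by (auto simp: V.finite_lin_indpt2)
  then have UT: "U \<subseteq> T" "V.lin_indpt U" by (auto simp: maximal_def)
  have "V.dim = card U"
    using V.dim_span[OF _ finT U(2)] T span by (simp add: module_vec_def)
  \<comment> \<open>A maximal independent set of spanning vectors is a basis, and its vectors are the columns of \<open>P\<close>.\<close>
  then have cU: "card U = n" by (simp add: V.dim_is_n)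
  obtain us where us: "distinct us" "set us = U"
    using U(1) finite_distinct_list by auto
  have lus: "length us = n" using us cU distinct_card by fastforce
  define P where "P = mat_of_cols n us"
  have P: "P \<in> carrier_mat n n" using lus unfolding P_def by (metis mat_of_cols_carrier(1))
  have colsP: "cols P = us" unfolding P_def using us UT T by (intro cols_mat_of_cols) auto
  have "V.rank P = n"
    by (rule V.lin_indpt_full_rank[OF P]) (use colsP us UT in auto)
  then have "det P \<noteq> 0" using V.det_rank_iff[OF P] by simp
  then have "P \<in> Units (ring_mat TYPE('k) n ())" by (rule det_non_zero_imp_unit[OF P])
  then obtain Q where PQ: "inverse_pair n P Q"
    by (auto simp: Units_def ring_mat_def inverse_pair_def)
  have "\<exists>i\<in>I. \<exists>v\<in>carrier_vec n. col P j = R i *\<^sub>v v" if j: "j < n" for j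
  proof -
    have "col P j = us ! j" using j lus colsP P by (metis carrier_matD(2) cols_nth)
    moreover have "us ! j \<in> U" using nth_mem[of j us] us(2) j lus by simp
    ultimately have "col P j \<in> T" using UT(1) by auto
    then obtain i k where "i \<in> I" "col P j = R i *\<^sub>v unit_vec n k" by (auto simp: T_def)
    then show ?thesis by (metis unit_vec_carrier)
  qed
  then obtain \<kappa> where k: "\<And>j. j < n \<Longrightarrow> \<kappa> j \<in> I"
    "\<And>j. j < n \<Longrightarrow> \<exists>v\<in>carrier_vec n. col P j = R (\<kappa> j) *\<^sub>v v" by metis
  show thesis
  proof (rule that[OF PQ k(1)])
    fix A c assume A: "A \<in> carrier_mat n n" and c: "\<And>i. i \<in> I \<Longrightarrow> A * R i = c i \<cdot>\<^sub>m R i"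
    have "A * P = P * mat_diag n (\<lambda>j. c (\<kappa> j))"
    proof (rule mat_col_eqI)
      fix j assume "j < dim_col (P * mat_diag n (\<lambda>j. c (\<kappa> j)))"
      then have j: "j < n" by (simp add: mat_diag_def)
      from k(2)[OF j] obtain v where v: "v \<in> carrier_vec n" "col P j = R (\<kappa> j) *\<^sub>v v" by blast
      have Rk: "R (\<kappa> j) \<in> carrier_mat n n" using R k(1) j by auto
      have "col (A * P) j = A *\<^sub>v (R (\<kappa> j) *\<^sub>v v)"
        unfolding v(2)[symmetric] by (rule col_mult2[OF A P j])
      also have "\<dots> = (A * R (\<kappa> j)) *\<^sub>v v"
        using A Rk v by (simp add: assoc_mult_mat_vec[of _ n n _ n])
      also have "\<dots> = c (\<kappa> j) \<cdot>\<^sub>v (R (\<kappa> j) *\<^sub>v v)"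
        using c[OF k(1)[OF j]] Rk v by (auto intro!: eq_vecI)
      also have "\<dots> = c (\<kappa> j) \<cdot>\<^sub>v col P j" using v by simp
      also have "\<dots> = col (P * mat_diag n (\<lambda>j. c (\<kappa> j))) j"
        using P j by (auto intro!: eq_vecI simp: mat_diag_mult_right[OF P])
      finally show "col (A * P) j = col (P * mat_diag n (\<lambda>j. c (\<kappa> j))) j" .
    qed (use A P in \<open>auto simp: mat_diag_def\<close>)
    then have "P * mat_diag n (\<lambda>j. c (\<kappa> j)) * Q = A * P * Q" by simp
    also have "\<dots> = A" by (rule inverse_pair_cancel[OF PQ A])
    finally show "A = P * mat_diag n (\<lambda>j. c (\<kappa> j)) * Q" ..
  qed
qed

lemma mat_sum_times:
  fixes R S :: "_ \<Rightarrow> 'k::comm_ring_1 mat"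
  assumes R: "\<And>x. x \<in> X \<Longrightarrow> R x \<in> carrier_mat n n" and S: "\<And>y. y \<in> Y \<Longrightarrow> S y \<in> carrier_mat n n"
  shows "mat_sum n (\<lambda>(x, y). R x * S y) (X \<times> Y) = mat_sum n R X * mat_sum n S Y"
proof -
  have "mat_sum n R X * mat_sum n S Y = mat_sum n (\<lambda>x. R x * mat_sum n S Y) X"
    using R by (intro mat_sum_mult) auto
  also have "\<dots> = mat_sum n (\<lambda>x. mat_sum n (\<lambda>y. R x * S y) Y) X"
    using R S by (intro mat_sum_cong mult_mat_sum) auto
  also have "\<dots> = mat_sum n (\<lambda>(x, y). R x * S y) (X \<times> Y)"
    by (rule eq_matI) (auto simp: sum.cartesian_product split_def)
  finally show ?thesis ..
qed

text \<open>
  In an eigenbasis of \<open>A\<close>, commuting with \<open>A\<close> means \<open>d\<^sub>i B\<^sub>i\<^sub>j = B\<^sub>i\<^sub>j d\<^sub>j\<close>: the entry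
  \<open>B\<^sub>i\<^sub>j\<close> vanishes unless \<open>d\<^sub>i = d\<^sub>j\<close>, and then also \<open>g d\<^sub>i = g d\<^sub>j\<close>. So \<open>B\<close> commutes with every
  function of \<open>A\<close>.
\<close>

lemma commute_function_of_diagonalized:
  fixes A :: "'k::field mat"
  assumes PQ: "inverse_pair n P Q" and e: "A = P * mat_diag n d * Q"
    and B: "B \<in> carrier_mat n n" and AB: "A * B = B * A"
  shows "P * mat_diag n (\<lambda>j. g (d j)) * Q * B = B * (P * mat_diag n (\<lambda>j. g (d j)) * Q)"
proof -
  note c = inverse_pairD[OF PQ]
  note s = square_mat_algebra[where n = n]
  define B' where "B' = Q * B * P"
  have B': "B' \<in> carrier_mat n n" using B c by (simp add: B'_def)
  have BB: "B = P * B' * Q"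
    using c B by (simp add: B'_def s inverse_pair_cancel[OF PQ])
  have "mat_diag n d * B' = Q * (A * B) * P"
    unfolding e BB using c B' by (simp add: s inverse_pair_cancel[OF PQ])
  also have "\<dots> = B' * mat_diag n d"
    unfolding AB unfolding e BB using c B' by (simp add: s inverse_pair_cancel[OF PQ])
  finally have comm: "mat_diag n d * B' = B' * mat_diag n d" .
  have d: "d i * B' $$ (i, j) = B' $$ (i, j) * d j" if ij: "i < n" "j < n" for i j
  proof -
    have "d i * B' $$ (i, j) = (mat_diag n d * B') $$ (i, j)"
      unfolding mat_diag_mult_left[OF B'] using ij by simp
    also have "\<dots> = B' $$ (i, j) * d j"
      unfolding comm mat_diag_mult_right[OF B'] using ij by simp
    finally show ?thesis .
  qed
  have "mat_diag n (\<lambda>j. g (d j)) * B' = B' * mat_diag n (\<lambda>j. g (d j))"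
    unfolding mat_diag_mult_left[OF B'] mat_diag_mult_right[OF B']
  proof (rule cong_mat[OF refl refl])
    fix i j assume "i < n" "j < n"
    with d[OF this] show "(case (i, j) of (i, j) \<Rightarrow> g (d i) * B' $$ (i, j)) =
        (case (i, j) of (i, j) \<Rightarrow> B' $$ (i, j) * g (d j))"
      by (cases "B' $$ (i, j) = 0") auto
  qed
  then have "P * (mat_diag n (\<lambda>j. g (d j)) * B') * Q = P * (B' * mat_diag n (\<lambda>j. g (d j))) * Q"
    by simp
  then show ?thesis
    unfolding BB conjugate_mult[OF PQ mat_diag_dim B'] conjugate_mult[OF PQ B' mat_diag_dim] .
qed

text \<open>
  Let \<open>R\<^sub>x\<close> and \<open>S\<^sub>y\<close> be the eigenprojections of \<open>A\<close> and \<open>B\<close>. Their products sum to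
  \<open>1\<close>, and since \<open>R\<^sub>x\<close> commutes with \<open>B\<close>, both \<open>A\<close> and \<open>B\<close> act on the image of
  \<open>R\<^sub>x S\<^sub>y\<close> as scalars.
\<close>

lemma simultaneous_diagonalization:
  fixes A B :: "'k::field mat"
  assumes A: "A \<in> carrier_mat n n" and B: "B \<in> carrier_mat n n"
    and dA: "diagonalizable A" and dB: "diagonalizable B" and AB: "A * B = B * A"
  obtains P Q a b where "inverse_pair n P Q" "A = P * mat_diag n a * Q" "B = P * mat_diag n b * Q"
proof -
  \<comment> \<open>\<open>pr P d Q x\<close> is the projection onto the eigenspace for \<open>x\<close> of \<open>P diag(d) Q\<close>.\<close>
  define pr :: "'k mat \<Rightarrow> (nat \<Rightarrow> 'k) \<Rightarrow> 'k mat \<Rightarrow> 'k \<Rightarrow> 'k mat" where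
    "pr = (\<lambda>P d Q x. P * mat_diag n (\<lambda>j. if d j = x then 1 else 0) * Q)"
  have pr: "pr P d Q x \<in> carrier_mat n n" "P * mat_diag n d * Q * pr P d Q x = x \<cdot>\<^sub>m pr P d Q x"
      "mat_sum n (pr P d Q) (d ` {..<n}) = 1\<^sub>m n"
    if PQ: "inverse_pair n P Q" for P Q d x
  proof -
    note c = inverse_pairD[OF PQ]
    show 1: "pr P d Q x \<in> carrier_mat n n" for x using c by (simp add: pr_def)
    have "mat_diag n d * mat_diag n (\<lambda>j. if d j = x then 1 else 0) =
        x \<cdot>\<^sub>m mat_diag n (\<lambda>j. if d j = x then 1 else 0)"
      unfolding mat_diag_diag by (auto simp: mat_diag_def)
    then show "P * mat_diag n d * Q * pr P d Q x = x \<cdot>\<^sub>m pr P d Q x"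
      unfolding pr_def conjugate_mult[OF PQ mat_diag_dim mat_diag_dim]
      using c by (simp add: square_mat_algebra[where n = n])
    have "mat_sum n (\<lambda>x. mat_diag n (\<lambda>j. if d j = x then 1 else 0)) (d ` {..<n}) = (1\<^sub>m n :: 'k mat)"
    proof (rule eq_matI)
      fix i j assume "i < dim_row (1\<^sub>m n)" "j < dim_col (1\<^sub>m n)"
      then have ij: "i < n" "j < n" by auto
      have "(\<Sum>x\<in>d ` {..<n}. (if i = j then if d j = x then 1 else 0 else 0)) = (if i = j then 1 else (0::'k))"
        using ij by auto
      then show "mat_sum n (\<lambda>x. mat_diag n (\<lambda>j. if d j = x then 1 else 0)) (d ` {..<n}) $$ (i, j) =
          (1\<^sub>m n) $$ (i, j)"
        using ij by (simp add: mat_diag_def)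
    qed auto
    moreover have "mat_sum n (pr P d Q) (d ` {..<n}) =
        P * mat_sum n (\<lambda>x. mat_diag n (\<lambda>j. if d j = x then 1 else 0)) (d ` {..<n}) * Q"
      unfolding pr_def using c by (simp add: mult_mat_sum mat_sum_mult)
    ultimately show "mat_sum n (pr P d Q) (d ` {..<n}) = 1\<^sub>m n" using c by simp
  qed
  from dA obtain P1 Q1 d1 where 1: "inverse_pair n P1 Q1" "A = P1 * mat_diag n d1 * Q1"
    by (auto simp: diagonalizable_iff[OF A])
  from dB obtain P2 Q2 d2 where 2: "inverse_pair n P2 Q2" "B = P2 * mat_diag n d2 * Q2"
    by (auto simp: diagonalizable_iff[OF B])
  define R where "R = pr P1 d1 Q1"
  define S where "S = pr P2 d2 Q2"
  note R = pr[OF 1(1), of d1, folded R_def 1(2)]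
  note S = pr[OF 2(1), of d2, folded S_def 2(2)]
  have RB: "R x * B = B * R x" for x
    using commute_function_of_diagonalized[OF 1 B AB, of "\<lambda>y. if y = x then 1 else 0"]
    by (simp add: R_def pr_def)
  define T where "T = (\<lambda>(x, y). R x * S y)"
  have "mat_sum n T (d1 ` {..<n} \<times> d2 ` {..<n}) = 1\<^sub>m n"
    unfolding T_def using R S by (simp add: mat_sum_times)
  then obtain P Q \<kappa> where *: "inverse_pair n P Q"
    "\<And>A c. A \<in> carrier_mat n n \<Longrightarrow>
       (\<And>i. i \<in> d1 ` {..<n} \<times> d2 ` {..<n} \<Longrightarrow> A * T i = c i \<cdot>\<^sub>m T i) \<Longrightarrow>
       A = P * mat_diag n (\<lambda>j. c (\<kappa> j)) * Q"
    by (rule diagonalize_resolution[rotated 2]) (use R S in \<open>auto simp: T_def\<close>)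
  have "A * (R x * S y) = x \<cdot>\<^sub>m (R x * S y)" for x y
  proof -
    have "A * (R x * S y) = (A * R x) * S y"
      using A R(1) S(1) by (simp add: square_mat_algebra[where n = n])
    also have "\<dots> = x \<cdot>\<^sub>m (R x * S y)"
      unfolding R(2) using R(1) S(1) by (simp add: square_mat_algebra[where n = n])
    finally show ?thesis .
  qed
  moreover have "B * (R x * S y) = y \<cdot>\<^sub>m (R x * S y)" for x y
  proof -
    have "B * (R x * S y) = B * R x * S y"
      using B R(1) S(1) by (simp add: square_mat_algebra[where n = n])
    also have "\<dots> = R x * (B * S y)"
      unfolding RB[symmetric] using B R(1) S(1) by (simp add: square_mat_algebra[where n = n])
    also have "\<dots> = y \<cdot>\<^sub>m (R x * S y)"
      unfolding S(2) using R(1) S(1) by (simp add: square_mat_algebra[where n = n])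
    finally show ?thesis .
  qed
  ultimately show thesis
    by (intro that[OF *(1), of "\<lambda>j. fst (\<kappa> j)" "\<lambda>j. snd (\<kappa> j)"] *(2)[of _ fst] *(2)[of _ snd])
      (use A B in \<open>auto simp: T_def\<close>)
qed

text \<open>
  A spectral resolution of \<open>S\<close> and an eigenbasis of \<open>S\<close> define the same functions of
  \<open>S\<close>: the entry of \<open>R\<^sub>a P\<close> in column \<open>j\<close> can only be nonzero if \<open>s\<^sub>j = l\<^sub>a\<close>, and then
  \<open>g s\<^sub>j = g l\<^sub>a\<close>.
\<close>

lemma spectral_sum_diagonalized:
  fixes S :: "'k::field mat"
  assumes PQ: "inverse_pair n P Q" and S: "S = P * mat_diag n s * Q"
    and R: "\<And>a. a \<in> I \<Longrightarrow> R a \<in> carrier_mat n n" and sum: "mat_sum n R I = 1\<^sub>m n"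
    and RS: "\<And>a. a \<in> I \<Longrightarrow> R a * S = l a \<cdot>\<^sub>m R a"
  shows "mat_sum n (\<lambda>a. g (l a) \<cdot>\<^sub>m R a) I = P * mat_diag n (\<lambda>j. g (s j)) * Q"
proof -
  note c = inverse_pairD[OF PQ]
  note alg = square_mat_algebra[where n = n]
  let ?G = "mat_diag n (\<lambda>j. g (s j))"
  have key: "g (l a) \<cdot>\<^sub>m R a = R a * (P * ?G * Q)" if a: "a \<in> I" for a
  proof -
    have Ra: "R a \<in> carrier_mat n n" and RP: "R a * P \<in> carrier_mat n n" using R[OF a] c by auto
    have "R a * P * mat_diag n s = R a * S * P"
      unfolding S using Ra c by (simp add: alg inverse_pair_cancel[OF PQ])
    also have "\<dots> = l a \<cdot>\<^sub>m (R a * P)" unfolding RS[OF a] using Ra c by (simp add: alg)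
    finally have eq: "R a * P * mat_diag n s = l a \<cdot>\<^sub>m (R a * P)" .
    have entry: "(R a * P) $$ (i, j) * s j = l a * (R a * P) $$ (i, j)" if "i < n" "j < n" for i j
      using arg_cong[OF eq, of "\<lambda>M. M $$ (i, j)"] that RP Ra c
      by (simp add: mat_diag_mult_right[OF RP])
    have "R a * P * ?G = g (l a) \<cdot>\<^sub>m (R a * P)"
      unfolding mat_diag_mult_right[OF RP]
    proof (rule eq_matI)
      fix i j assume "i < dim_row (g (l a) \<cdot>\<^sub>m (R a * P))" "j < dim_col (g (l a) \<cdot>\<^sub>m (R a * P))"
      then have ij: "i < n" "j < n" using Ra c by auto
      have "(R a * P) $$ (i, j) * g (s j) = g (l a) * (R a * P) $$ (i, j)"
        using entry[OF ij] by (cases "(R a * P) $$ (i, j) = 0") auto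
      moreover have "dim_row (R a * P) = n" "dim_col (R a * P) = n" using Ra c by auto
      ultimately show "mat n n (\<lambda>(i, j). (R a * P) $$ (i, j) * g (s j)) $$ (i, j) =
          (g (l a) \<cdot>\<^sub>m (R a * P)) $$ (i, j)"
        using ij by (simp del: index_mult_mat)
    qed (use Ra c in auto)
    then have "R a * P * ?G * Q = g (l a) \<cdot>\<^sub>m (R a * P) * Q" by simp
    then show ?thesis using Ra c by (simp add: alg)
  qed
  have "mat_sum n (\<lambda>a. g (l a) \<cdot>\<^sub>m R a) I = mat_sum n (\<lambda>a. R a * (P * ?G * Q)) I"
    by (rule mat_sum_cong) (rule key)
  also have "\<dots> = mat_sum n R I * (P * ?G * Q)"
    using R c by (simp add: mat_sum_mult)
  finally show ?thesis using c sum by simp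
qed

section \<open>Uniqueness of the Jordan-Chevalley decomposition\<close>

lemma pow_mat_commuting:
  fixes A B :: "'k::comm_ring_1 mat"
  assumes A: "A \<in> carrier_mat n n" and B: "B \<in> carrier_mat n n" and AB: "A * B = B * A"
  shows "A ^\<^sub>m k * B = B * A ^\<^sub>m k"
  using poly_mat_commuting[OF assms, of "[:0, 1:] ^ k"] A
  by (simp add: poly_mat_power[OF A])

lemma nilpotent_diff:
  fixes A B :: "'k::field mat"
  assumes A: "A \<in> carrier_mat n n" and B: "B \<in> carrier_mat n n" and AB: "A * B = B * A"
    and nA: "nilpotent_mat A" and nB: "nilpotent_mat B"
  shows "nilpotent_mat (A - B)"
proof -
  note alg = square_mat_algebra[where n = n]
  obtain p q where p: "A ^\<^sub>m p = 0\<^sub>m n n" and q: "B ^\<^sub>m q = 0\<^sub>m n n"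
    using nA nB A B by (auto simp: nilpotent_mat_def)
  have AB': "A - B \<in> carrier_mat n n" using A B by (auto simp: minus_carrier_mat)
  have vanish: "X ^\<^sub>m j = 0\<^sub>m n n" if X: "X \<in> carrier_mat n n" "X ^\<^sub>m i = 0\<^sub>m n n" "i \<le> j"
    for X :: "'k mat" and i j
    using that(3) by (induction rule: dec_induct) (use X in auto)
  \<comment> \<open>Multiplying out one factor \<open>A - B\<close> at a time replaces the binomial theorem.\<close>
  have "(A - B) ^\<^sub>m k * (A ^\<^sub>m i * B ^\<^sub>m j) = 0\<^sub>m n n" if "p + q \<le> i + j + k" for i j k
    using that
  proof (induction k arbitrary: i j)
    case 0
    then have "p \<le> i \<or> q \<le> j" by arith
    then have "A ^\<^sub>m i = 0\<^sub>m n n \<or> B ^\<^sub>m j = 0\<^sub>m n n"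
      using vanish[OF A p] vanish[OF B q] by blast
    then have "A ^\<^sub>m i * B ^\<^sub>m j = 0\<^sub>m n n" using A B pow_carrier_mat[OF A, of i] pow_carrier_mat[OF B, of j] by auto
    then show ?case using AB' by auto
  next
    case (Suc k)
    have a: "A * (A ^\<^sub>m i * B ^\<^sub>m j) = A ^\<^sub>m Suc i * B ^\<^sub>m j"
      using A B pow_mat_commuting[OF A A, of i] by (simp add: alg(1)[symmetric])
    have "B * (A ^\<^sub>m i * B ^\<^sub>m j) = A ^\<^sub>m i * (B * B ^\<^sub>m j)"
      using A B pow_mat_commuting[OF A B AB, of i] by (simp add: alg(1)[symmetric])
    also have "\<dots> = A ^\<^sub>m i * B ^\<^sub>m Suc j"
      using B pow_mat_commuting[OF B B, of j] by simp
    finally have b: "B * (A ^\<^sub>m i * B ^\<^sub>m j) = A ^\<^sub>m i * B ^\<^sub>m Suc j" .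
    have "(A - B) ^\<^sub>m Suc k * (A ^\<^sub>m i * B ^\<^sub>m j) =
        (A - B) ^\<^sub>m k * (A * (A ^\<^sub>m i * B ^\<^sub>m j) - B * (A ^\<^sub>m i * B ^\<^sub>m j))"
      using A B AB' by (simp add: alg)
    also have "\<dots> = (A - B) ^\<^sub>m k * (A ^\<^sub>m Suc i * B ^\<^sub>m j) - (A - B) ^\<^sub>m k * (A ^\<^sub>m i * B ^\<^sub>m Suc j)"
      unfolding a b using A B AB' by (intro alg(5)) (auto simp del: pow_mat.simps)
    also have "\<dots> = 0\<^sub>m n n"
      using Suc.IH[of "Suc i" j] Suc.IH[of i "Suc j"] Suc.prems by (simp del: pow_mat.simps)
    finally show ?case .
  qed
  from this[of 0 0 "p + q"] have "(A - B) ^\<^sub>m (p + q) = 0\<^sub>m n n"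
    using A B pow_carrier_mat[OF AB', of "p + q"] by simp
  moreover have "dim_row (A - B) = n" using AB' by blast
  ultimately show ?thesis unfolding nilpotent_mat_def by metis
qed

lemma nilpotent_diagonalized_zero:
  fixes P :: "'k::field mat"
  assumes PQ: "inverse_pair n P Q" and nil: "nilpotent_mat (P * mat_diag n d * Q)"
  shows "P * mat_diag n d * Q = 0\<^sub>m n n"
proof -
  note c = inverse_pairD[OF PQ]
  obtain k where "(P * mat_diag n d * Q) ^\<^sub>m k = 0\<^sub>m n n"
    using nil c by (auto simp: nilpotent_mat_def)
  moreover have pow: "(P * mat_diag n d * Q) ^\<^sub>m k = P * mat_diag n (\<lambda>j. d j ^ k) * Q" for k
  proof (induction k)
    case (Suc k)
    then show ?case using c by (simp add: conjugate_mult[OF PQ] mult.commute)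
  qed (use c in simp)
  ultimately have "Q * (P * mat_diag n (\<lambda>j. d j ^ k) * Q) * P = 0\<^sub>m n n" using c by simp
  then have "mat_diag n (\<lambda>j. d j ^ k) = 0\<^sub>m n n"
    using c by (simp add: square_mat_algebra[where n = n] inverse_pair_cancel[OF PQ])
  then have "mat_diag n (\<lambda>j. d j ^ k) $$ (j, j) = 0" if "j < n" for j using that by simp
  then have "d j = 0" if "j < n" for j using that by (auto simp: mat_diag_def)
  then have "mat_diag n d = 0\<^sub>m n n" by (auto simp: mat_diag_def)
  then show ?thesis using c by simp
qed

text \<open>
  The known semisimple part is a polynomial in \<open>E\<close>, hence commutes with \<open>S'\<close> and \<open>N'\<close>, which
  commute with \<open>E = S' + N'\<close>. Thus \<open>S - S' = N' - N\<close> is diagonal in a common eigenbasis and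
  nilpotent at the same time.
\<close>

theorem jordan_chevalley_unique:
  fixes E :: "'k::field mat"
  assumes E: "E \<in> carrier_mat n n"
    and JC: "jordan_chevalley E (poly_mat p E) N" and JC': "jordan_chevalley E S' N'"
  shows "S' = poly_mat p E" "N' = N"
proof -
  note alg = square_mat_algebra[where n = n]
  define S where "S = poly_mat p E"
  have S: "S \<in> carrier_mat n n" using E by (simp add: S_def)
  have d: "N \<in> carrier_mat n n" "diagonalizable S" "nilpotent_mat N" "S * N = N * S" "E = S + N"
    using JC E unfolding jordan_chevalley_def S_def by auto
  have d': "S' \<in> carrier_mat n n" "N' \<in> carrier_mat n n" "diagonalizable S'" "nilpotent_mat N'"
      "S' * N' = N' * S'" "E = S' + N'"
    using JC' E unfolding jordan_chevalley_def by auto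
  have N: "N = E - S" using d S by (auto intro!: eq_matI)
  have N': "N' = E - S'"
    unfolding d'(6) using d'(1,2) by (auto intro!: eq_matI)
  have ES': "E * S' = S' * E" unfolding d'(6) using d' by (simp add: alg)
  have SS': "S * S' = S' * S" unfolding S_def by (rule poly_mat_commuting[OF E d'(1) ES'])
  have ES: "E * S = S * E"
    using poly_mat_commute[OF E, of "[:0, 1:]" p] E by (simp add: S_def)
  have "N' * N = N * N'"
    unfolding N N' using E S d' ES ES' SS'
    by (auto simp: alg minus_carrier_mat intro!: eq_matI)
  then have nil: "nilpotent_mat (N' - N)" using d d' by (intro nilpotent_diff) auto
  obtain P Q a b where *: "inverse_pair n P Q" "S = P * mat_diag n a * Q" "S' = P * mat_diag n b * Q"
    using simultaneous_diagonalization[OF S d'(1) d(2) d'(3) SS'] .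
  have "N' - N = S - S'" unfolding N N' using E S d' by (auto intro!: eq_matI)
  also have "\<dots> = P * (mat_diag n a - mat_diag n b) * Q"
    unfolding * using inverse_pairD[OF *(1)] by (simp add: alg minus_carrier_mat)
  also have "mat_diag n a - mat_diag n b = mat_diag n (\<lambda>j. a j - b j)"
    by (auto simp: mat_diag_def)
  finally have NN: "N' - N = P * mat_diag n (\<lambda>j. a j - b j) * Q" .
  have "S - S' = 0\<^sub>m n n"
    using nilpotent_diagonalized_zero[OF *(1) nil[unfolded NN]] NN \<open>N' - N = S - S'\<close> by simp
  then have "(S - S') $$ (i, j) = 0" if "i < n" "j < n" for i j using that by simp
  then have "S' $$ (i, j) = S $$ (i, j)" if "i < n" "j < n" for i j
    using that S d'(1) by simp
  then have "S' = S" using S d' by (intro eq_matI) auto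
  then show "S' = poly_mat p E" "N' = N" by (simp_all add: S_def N N')
qed

section \<open>The functional calculus of a family of polynomial idempotents\<close>

lemma dvd_diff_mult:
  fixes q :: "'r::comm_ring_1"
  assumes "q dvd x - u" "q dvd y - v"
  shows "q dvd x * y - u * v"
proof -
  have "x * y - u * v = (x - u) * y + u * (y - v)" by (simp add: algebra_simps)
  then show ?thesis using assms by (metis dvd_add dvd_mult dvd_mult2)
qed

lemma dvd_diff_trans:
  fixes q :: "'r::comm_ring_1"
  assumes "q dvd x - u" "q dvd y - u"
  shows "q dvd x - y"
  using dvd_diff[OF assms] by simp

text \<open>
  The setting isolates what is needed from a partial fraction decomposition
  \<open>\<Sum> C\<^sub>a = 1\<close>: each \<open>C\<^sub>b\<close> is divisible by the powers \<open>(X - l\<^sub>a)^\<mu>\<^sub>a\<close> that belong to the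
  other indices \<open>a\<close>, and common multiples of all powers vanish at \<open>E\<close>.
\<close>

locale spectral_idempotents =
  fixes n :: nat and E :: "'k::field mat" and I :: "'i set" and l :: "'i \<Rightarrow> 'k"
    and \<mu> :: "'i \<Rightarrow> nat" and C :: "'i \<Rightarrow> 'k poly"
  assumes E: "E \<in> carrier_mat n n"
    and fin: "finite I"
    and pos: "\<And>a. a \<in> I \<Longrightarrow> 0 < \<mu> a"
    and other: "\<And>a b. a \<in> I \<Longrightarrow> b \<in> I \<Longrightarrow> a \<noteq> b \<Longrightarrow> [:- l a, 1:] ^ \<mu> a dvd C b"
    and sumC: "(\<Sum>a\<in>I. C a) = 1"
    and vanish: "\<And>p. (\<And>a. a \<in> I \<Longrightarrow> [:- l a, 1:] ^ \<mu> a dvd p) \<Longrightarrow> poly_mat p E = 0\<^sub>m n n"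
begin

text \<open>
  The value of the calculus at \<open>g\<close> is \<open>\<Sum> g(l\<^sub>a) C\<^sub>a(E)\<close>, the matrix usually written \<open>g(S)\<close>
  for the semisimple part \<open>S\<close> of \<open>E\<close>. It is kept as a polynomial in \<open>E\<close>, so that all its
  values commute.
\<close>

definition calc_poly :: "('k \<Rightarrow> 'k) \<Rightarrow> 'k poly" where
  "calc_poly g = (\<Sum>a\<in>I. Polynomial.smult (g (l a)) (C a))"

definition calc :: "('k \<Rightarrow> 'k) \<Rightarrow> 'k mat" where
  "calc g = poly_mat (calc_poly g) E"

abbreviation spec_proj :: "'i \<Rightarrow> 'k mat" where
  "spec_proj a \<equiv> poly_mat (C a) E"

lemma calc_carrier [simp]: "calc g \<in> carrier_mat n n"
  using E by (simp add: calc_def)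

lemma spec_proj_carrier [simp]: "spec_proj a \<in> carrier_mat n n"
  using E by simp

text \<open>
  Identities between polynomials in \<open>E\<close> are checked locally, modulo one power at a time.
\<close>

lemma eval_eqI:
  assumes "\<And>a. a \<in> I \<Longrightarrow> [:- l a, 1:] ^ \<mu> a dvd p - q"
  shows "poly_mat p E = poly_mat q E"
proof -
  have *: "poly_mat p E - poly_mat q E = 0\<^sub>m n n"
    using vanish[OF assms] by (simp add: poly_mat_diff[OF E])
  have carr: "poly_mat p E \<in> carrier_mat n n" "poly_mat q E \<in> carrier_mat n n" using E by simp_all
  show ?thesis
  proof (rule eq_matI)
    fix i j assume "i < dim_row (poly_mat q E)" "j < dim_col (poly_mat q E)"
    then have ij: "i < n" "j < n" using carr by auto
    then have "(poly_mat p E - poly_mat q E) $$ (i, j) = 0" unfolding * by simp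
    moreover have "(poly_mat p E - poly_mat q E) $$ (i, j) = poly_mat p E $$ (i, j) - poly_mat q E $$ (i, j)"
      using ij carr by (intro index_minus_mat) auto
    ultimately show "poly_mat p E $$ (i, j) = poly_mat q E $$ (i, j)" by simp
  qed (use carr in auto)
qed

text \<open>
  Since all \<open>C\<^sub>c\<close> with \<open>c \<noteq> a\<close> vanish modulo the power at \<open>a\<close>, the equation
  \<open>\<Sum> C\<^sub>c = 1\<close> forces \<open>C\<^sub>a \<equiv> 1\<close> there.
\<close>

lemma C_local:
  assumes a: "a \<in> I" and b: "b \<in> I"
  shows "[:- l a, 1:] ^ \<mu> a dvd C b - (if b = a then 1 else 0)"
proof (cases "b = a")
  case True
  have "C a - 1 = - (\<Sum>c\<in>I - {a}. C c)"
    using sumC sum.remove[OF fin a, of C] by (simp add: algebra_simps)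
  moreover have "[:- l a, 1:] ^ \<mu> a dvd (\<Sum>c\<in>I - {a}. C c)"
    using other a by (intro dvd_sum) auto
  ultimately show ?thesis using True by simp
next
  case False
  then show ?thesis using other[OF a b] by simp
qed

text \<open>
  Writing \<open>g(l\<^sub>a)\<close> as \<open>\<Sum> g(l\<^sub>a) C\<^sub>b\<close>, the term of the difference with index \<open>a\<close>
  cancels and all the others are divisible by the power at \<open>a\<close>.
\<close>

lemma calc_poly_local:
  assumes a: "a \<in> I"
  shows "[:- l a, 1:] ^ \<mu> a dvd calc_poly g - [:g (l a):]"
proof -
  have "[:g (l a):] = Polynomial.smult (g (l a)) (\<Sum>b\<in>I. C b)"
    by (simp add: sumC one_pCons)
  then have "calc_poly g - [:g (l a):] = (\<Sum>b\<in>I. Polynomial.smult (g (l b) - g (l a)) (C b))"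
    by (simp add: calc_poly_def smult_sum2 smult_diff_left sum_subtractf)
  moreover have "[:- l a, 1:] ^ \<mu> a dvd \<dots>"
  proof (intro dvd_sum)
    fix b assume "b \<in> I"
    then show "[:- l a, 1:] ^ \<mu> a dvd Polynomial.smult (g (l b) - g (l a)) (C b)"
      using other[OF a, of b] by (cases "a = b") (auto intro: dvd_smult)
  qed
  ultimately show ?thesis by simp
qed

lemma calc_eq_sum: "calc g = mat_sum n (\<lambda>a. g (l a) \<cdot>\<^sub>m spec_proj a) I"
  unfolding calc_def calc_poly_def by (simp add: poly_mat_sum[OF E] poly_mat_smult[OF E])

lemma calc_cong:
  assumes "\<And>a. a \<in> I \<Longrightarrow> g (l a) = h (l a)"
  shows "calc g = calc h"
  unfolding calc_eq_sum by (rule mat_sum_cong) (simp add: assms)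

lemma calc_one: "calc (\<lambda>_. 1) = 1\<^sub>m n"
  using E by (simp add: calc_def calc_poly_def sumC)

lemma calc_mult: "calc g * calc h = calc (\<lambda>z. g z * h z)"
proof -
  have "poly_mat (calc_poly g * calc_poly h) E = poly_mat (calc_poly (\<lambda>z. g z * h z)) E"
  proof (rule eval_eqI)
    fix a assume a: "a \<in> I"
    have "[:- l a, 1:] ^ \<mu> a dvd calc_poly g * calc_poly h - [:g (l a):] * [:h (l a):]"
      by (intro dvd_diff_mult calc_poly_local a)
    also have "[:g (l a):] * [:h (l a):] = [:g (l a) * h (l a):]" by simp
    finally show "[:- l a, 1:] ^ \<mu> a dvd calc_poly g * calc_poly h - calc_poly (\<lambda>z. g z * h z)"
      using calc_poly_local[OF a, of "\<lambda>z. g z * h z"] by (rule dvd_diff_trans)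
  qed
  then show ?thesis by (simp add: calc_def poly_mat_mult[OF E])
qed

lemma calc_sum: "mat_sum n (\<lambda>x. calc (g x)) X = calc (\<lambda>z. \<Sum>x\<in>X. g x z)"
  unfolding calc_eq_sum
proof (rule eq_matI)
  fix i j assume "i < dim_row (mat_sum n (\<lambda>a. (\<Sum>x\<in>X. g x (l a)) \<cdot>\<^sub>m spec_proj a) I)"
    "j < dim_col (mat_sum n (\<lambda>a. (\<Sum>x\<in>X. g x (l a)) \<cdot>\<^sub>m spec_proj a) I)"
  then have ij: "i < n" "j < n" by auto
  have [simp]: "dim_row (spec_proj a) = n" "dim_col (spec_proj a) = n" for a using spec_proj_carrier[of a] by blast+
  show "mat_sum n (\<lambda>x. mat_sum n (\<lambda>a. g x (l a) \<cdot>\<^sub>m spec_proj a) I) X $$ (i, j) =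
      mat_sum n (\<lambda>a. (\<Sum>x\<in>X. g x (l a)) \<cdot>\<^sub>m spec_proj a) I $$ (i, j)"
    using ij by (simp add: sum_distrib_right del: poly_mat_dim) (rule sum.swap)
qed auto

lemma calc_scale: "calc (\<lambda>z. c * g z) = c \<cdot>\<^sub>m calc g"
proof -
  have "calc_poly (\<lambda>z. c * g z) = Polynomial.smult c (calc_poly g)"
    by (simp add: calc_poly_def smult_sum2)
  then show ?thesis by (simp add: calc_def poly_mat_smult[OF E])
qed

lemma spec_proj_sum: "mat_sum n spec_proj I = 1\<^sub>m n"
  using E by (simp add: poly_mat_sum[OF E, symmetric] sumC)

lemma spec_proj_mult:
  assumes "a \<in> I" "b \<in> I"
  shows "spec_proj a * spec_proj b = (if a = b then spec_proj a else 0\<^sub>m n n)"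
proof -
  have "poly_mat (C a * C b) E = poly_mat (if a = b then C a else 0) E"
  proof (rule eval_eqI)
    fix c assume c: "c \<in> I"
    have "[:- l c, 1:] ^ \<mu> c dvd C a * C b - (if a = c then 1 else 0) * (if b = c then 1 else 0)"
      by (intro dvd_diff_mult C_local c assms)
    moreover have "[:- l c, 1:] ^ \<mu> c dvd
        (if a = b then C a else 0) - (if a = c then 1 else 0) * (if b = c then 1 else 0)"
      using C_local[OF c assms(1)] by auto
    ultimately show "[:- l c, 1:] ^ \<mu> c dvd C a * C b - (if a = b then C a else 0)"
      by (rule dvd_diff_trans)
  qed
  then show ?thesis using E by (auto simp: poly_mat_mult[OF E])
qed

lemma calc_mult_spec_proj:
  assumes "a \<in> I"
  shows "calc g * spec_proj a = g (l a) \<cdot>\<^sub>m spec_proj a" "spec_proj a * calc g = g (l a) \<cdot>\<^sub>m spec_proj a"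
proof -
  have "poly_mat (calc_poly g * C a) E = poly_mat (Polynomial.smult (g (l a)) (C a)) E"
  proof (rule eval_eqI)
    fix c assume c: "c \<in> I"
    have "[:- l c, 1:] ^ \<mu> c dvd C a * (calc_poly g - [:g (l a):])"
      using calc_poly_local[OF c, of g] C_local[OF c assms] by (cases "a = c") auto
    moreover have "C a * (calc_poly g - [:g (l a):]) = calc_poly g * C a - Polynomial.smult (g (l a)) (C a)"
      by (simp add: algebra_simps)
    ultimately show "[:- l c, 1:] ^ \<mu> c dvd calc_poly g * C a - Polynomial.smult (g (l a)) (C a)"
      by simp
  qed
  then show "calc g * spec_proj a = g (l a) \<cdot>\<^sub>m spec_proj a"
    by (simp add: calc_def poly_mat_mult[OF E] poly_mat_smult[OF E])
  then show "spec_proj a * calc g = g (l a) \<cdot>\<^sub>m spec_proj a"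
    by (simp add: calc_def poly_mat_commute[OF E, of "C a"])
qed

text \<open>
  When the \<open>l\<^sub>a\<close> are distinct, the idempotents are themselves values of the calculus, at the
  indicator functions of single points. So the effect of conjugation on them follows from \<open>map_calc\<close>.
\<close>

lemma spec_proj_eq_calc:
  assumes inj: "inj_on l I" and a: "a \<in> I"
  shows "spec_proj a = calc (\<lambda>z. if z = l a then 1 else 0)"
proof -
  have "calc_poly (\<lambda>z. if z = l a then 1 else 0) = (\<Sum>b\<in>I. if b = a then C b else 0)"
    unfolding calc_poly_def using inj a by (intro sum.cong) (auto simp: inj_on_eq_iff)
  also have "\<dots> = C a" using fin a by simp
  finally show ?thesis by (simp add: calc_def)
qed

lemma calc_diagonalized:
  obtains P Q \<kappa> where "inverse_pair n P Q" "\<And>j. j < n \<Longrightarrow> \<kappa> j \<in> I"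
    "\<And>g. calc g = P * mat_diag n (\<lambda>j. g (l (\<kappa> j))) * Q"
proof -
  obtain P Q \<kappa> where "inverse_pair n P Q" "\<And>j. j < n \<Longrightarrow> \<kappa> j \<in> I"
    "\<And>A c. A \<in> carrier_mat n n \<Longrightarrow> (\<And>i. i \<in> I \<Longrightarrow> A * spec_proj i = c i \<cdot>\<^sub>m spec_proj i) \<Longrightarrow>
       A = P * mat_diag n (\<lambda>j. c (\<kappa> j)) * Q"
    by (rule diagonalize_resolution[OF fin spec_proj_carrier spec_proj_sum]) blast
  from that[OF this(1,2) this(3)[OF calc_carrier calc_mult_spec_proj(1)]] show thesis .
qed

lemma diagonalizable_calc: "diagonalizable (calc g)"
  using calc_diagonalized by (metis diagonalizable_iff[OF calc_carrier])

lemma eigenvalue_calc: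
  assumes "eigenvalue (calc g) x" obtains a where "a \<in> I" "x = g (l a)"
proof -
  obtain P Q \<kappa> where *: "inverse_pair n P Q" "\<And>j. j < n \<Longrightarrow> \<kappa> j \<in> I"
    "\<And>g. calc g = P * mat_diag n (\<lambda>j. g (l (\<kappa> j))) * Q"
    by (rule calc_diagonalized) blast
  show thesis using assms that *(2) unfolding eigenvalue_diagonalized[OF *(1) *(3)] by auto
qed

text \<open>
  Modulo \<open>X - l\<^sub>a\<close> the polynomial of the identity function is \<open>l\<^sub>a\<close>, and so is \<open>X\<close>. Hence
  \<open>X\<close> minus that polynomial is divisible by every \<open>X - l\<^sub>a\<close>, and its power with exponent
  \<open>max \<mu>\<close> vanishes at \<open>E\<close>.
\<close>

lemma jordan_chevalley_calc: "jordan_chevalley E (calc (\<lambda>z. z)) (E - calc (\<lambda>z. z))"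
proof -
  let ?s = "calc_poly (\<lambda>z. z)"
  define k where "k = Max (\<mu> ` I)"
  have N: "E - calc (\<lambda>z. z) = poly_mat ([:0, 1:] - ?s) E"
    using E by (simp add: calc_def poly_mat_diff[OF E])
  have "poly_mat (([:0, 1:] - ?s) ^ k) E = 0\<^sub>m n n"
  proof (rule vanish)
    fix a assume a: "a \<in> I"
    have "[:- l a, 1:] dvd [:- l a, 1:] ^ \<mu> a" using pos[OF a] by (simp add: dvd_power)
    then have "[:- l a, 1:] dvd ?s - [:l a:]" using calc_poly_local[OF a, of "\<lambda>z. z"] by (rule dvd_trans)
    then have "[:- l a, 1:] dvd [:- l a, 1:] - (?s - [:l a:])" by (rule dvd_diff[OF dvd_refl])
    moreover have "[:- l a, 1:] - (?s - [:l a:]) = [:0, 1:] - ?s" by (simp add: algebra_simps)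
    ultimately have "[:- l a, 1:] ^ k dvd ([:0, 1:] - ?s) ^ k" by (simp add: dvd_power_same)
    moreover have "\<mu> a \<le> k" using a fin by (simp add: k_def)
    ultimately show "[:- l a, 1:] ^ \<mu> a dvd ([:0, 1:] - ?s) ^ k"
      by (meson dvd_trans le_imp_power_dvd)
  qed
  then have nil: "nilpotent_mat (E - calc (\<lambda>z. z))"
    unfolding N nilpotent_mat_def using E by (auto simp: poly_mat_power[OF E, symmetric])
  have com: "calc (\<lambda>z. z) * (E - calc (\<lambda>z. z)) = (E - calc (\<lambda>z. z)) * calc (\<lambda>z. z)"
    unfolding N unfolding calc_def by (rule poly_mat_commute[OF E])
  have E2: "E = calc (\<lambda>z. z) + (E - calc (\<lambda>z. z))"
    using E carrier_matD[OF calc_carrier[of "\<lambda>z. z"]] by (intro eq_matI) auto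
  show ?thesis
    unfolding jordan_chevalley_def
    using com nil E2 E diagonalizable_calc calc_carrier[of "\<lambda>z. z"] by (auto simp: minus_carrier_mat)
qed

lemma jordan_chevalley_iff:
  "jordan_chevalley E S N \<longleftrightarrow> S = calc (\<lambda>z. z) \<and> N = E - calc (\<lambda>z. z)"
  using jordan_chevalley_calc jordan_chevalley_unique[OF E jordan_chevalley_calc[unfolded calc_def], of S N]
  unfolding calc_def by blast

text \<open>
  Each power \<open>(X - l\<^sub>a)^\<mu>\<^sub>a\<close> is the image under \<open>\<sigma>\<close> of another one, at a point
  \<open>l\<^sub>b\<close>. So \<open>\<sigma>\<close> carries the congruence \<open>calc_poly g \<equiv> g(l\<^sub>b)\<close> at \<open>b\<close> to the congruence that
  characterizes \<open>calc_poly h\<close> at \<open>a\<close>.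
\<close>

lemma map_calc:
  assumes h: "comm_ring_hom \<sigma>" and E\<sigma>: "map_mat \<sigma> E = E"
    and stable: "\<And>a. a \<in> I \<Longrightarrow> \<exists>b\<in>I. l a = \<sigma> (l b) \<and> \<mu> a = \<mu> b"
    and gh: "\<And>b. b \<in> I \<Longrightarrow> h (\<sigma> (l b)) = \<sigma> (g (l b))"
  shows "map_mat \<sigma> (calc g) = calc h"
proof -
  interpret comm_ring_hom \<sigma> by (rule h)
  interpret p: map_poly_comm_ring_hom \<sigma> ..
  have "poly_mat (map_poly \<sigma> (calc_poly g)) E = poly_mat (calc_poly h) E"
  proof (rule eval_eqI)
    fix a assume a: "a \<in> I"
    obtain b where b: "b \<in> I" "l a = \<sigma> (l b)" "\<mu> a = \<mu> b" using stable[OF a] by blast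
    obtain k where k: "calc_poly g - [:g (l b):] = [:- l b, 1:] ^ \<mu> b * k"
      using calc_poly_local[OF b(1), of g] by (auto simp: dvd_def)
    have "map_poly \<sigma> (calc_poly g) - [:h (l a):] = map_poly \<sigma> (calc_poly g - [:g (l b):])"
      using gh[OF b(1)] b(2) by (simp add: p.hom_minus hom_distribs)
    also have "\<dots> = [:- l a, 1:] ^ \<mu> a * map_poly \<sigma> k"
      unfolding k b(2,3) by (simp add: hom_distribs)
    finally have "[:- l a, 1:] ^ \<mu> a dvd map_poly \<sigma> (calc_poly g) - [:h (l a):]" by simp
    then show "[:- l a, 1:] ^ \<mu> a dvd map_poly \<sigma> (calc_poly g) - calc_poly h"
      using calc_poly_local[OF a] by (rule dvd_diff_trans)
  qed
  then show ?thesis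
    using poly_mat_hom[OF h E, of "calc_poly g"] E\<sigma> by (simp add: calc_def)
qed

end

section \<open>Matrices over an ordered field inside its extension by a square root of -1\<close>

lemma of_base_simps [simp]:
  "re_part (of_base a) = a" "im_part (of_base a) = 0"
  "of_base 0 = 0" "of_base 1 = 1"
  by (simp_all add: of_base_def adjoin_i_defs)

lemma adjoin_i_parts [simp]:
  "re_part 0 = 0" "im_part 0 = 0" "re_part 1 = 1" "im_part 1 = 0"
  "re_part (x + y) = re_part x + re_part y" "im_part (x + y) = im_part x + im_part y"
  "re_part (x - y) = re_part x - re_part y" "im_part (x - y) = im_part x - im_part y"
  "re_part (- x) = - re_part x" "im_part (- x) = - im_part x"
  "re_part (x * y) = re_part x * re_part y - im_part x * im_part y"
  "im_part (x * y) = re_part x * im_part y + im_part x * re_part y"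
  "re_part (conj_i x) = re_part x" "im_part (conj_i x) = - im_part x"
  by (simp_all add: adjoin_i_defs conj_i_def)

lemma of_base_inj [simp]: "of_base x = of_base y \<longleftrightarrow> x = y"
  by (simp add: of_base_def)

lemma comm_ring_hom_of_base: "comm_ring_hom of_base"
  by unfold_locales (simp_all add: adjoin_i_eq_iff)

lemma comm_ring_hom_conj_i: "comm_ring_hom conj_i"
  by unfold_locales (simp_all add: adjoin_i_eq_iff)

lemma in_range_of_base_iff: "z \<in> range of_base \<longleftrightarrow> im_part z = 0"
  by (auto simp: adjoin_i_eq_iff image_iff intro: exI[of _ "re_part z"])

lemma conj_i_eq_self_iff: "conj_i z = z \<longleftrightarrow> im_part z = 0"
  by (auto simp: adjoin_i_eq_iff)

lemma conj_i_of_base [simp]: "conj_i (of_base a) = of_base a"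
  by (simp add: adjoin_i_eq_iff)

lemma conj_i_conj_i [simp]: "conj_i (conj_i z) = z"
  by (simp add: adjoin_i_eq_iff)

lemma conj_i_divide: "conj_i (x / y) = conj_i x / conj_i y" "conj_i (inverse x) = inverse (conj_i x)"
  by (simp_all add: adjoin_i_eq_iff divide_adjoin_i_def inverse_adjoin_i_def)

lemma map_mat_conj_ext [simp]: "map_mat conj_i (ext_mat M) = ext_mat M"
  by (rule eq_matI) auto

lemma map_mat_zero: "h 0 = 0 \<Longrightarrow> map_mat h (0\<^sub>m n n) = 0\<^sub>m n n"
  by (rule eq_matI) auto

lemma ext_mat_inj: "ext_mat A = ext_mat B \<longleftrightarrow> A = B"
proof
  assume "ext_mat A = ext_mat B"
  then have "map_mat re_part (ext_mat A) = map_mat re_part (ext_mat B)" by simp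
  moreover have "map_mat re_part (ext_mat X) = X" for X :: "'a mat"
    by (rule eq_matI) auto
  ultimately show "A = B" by simp
qed simp

text \<open>
  The powers of \<open>M\<close> have entries in the ordered field. So a map \<open>h\<close> that is linear over that
  field, such as the real or the imaginary part, only acts on the coefficients of the polynomial.
\<close>

lemma additive_part_poly_mat:
  assumes M: "M \<in> carrier_mat n n"
    and h: "h 0 = 0" "\<And>x y. h (x + y) = h x + h y" "\<And>x y. h (x * of_base y) = h x * y"
  shows "map_mat h (poly_mat p (ext_mat M)) = poly_mat (map_poly h p) M"
proof (rule eq_matI)
  interpret b: comm_ring_hom of_base by (rule comm_ring_hom_of_base)
  have EM: "ext_mat M \<in> carrier_mat n n" using M by simp
  fix i j assume "i < dim_row (poly_mat (map_poly h p) M)" "j < dim_col (poly_mat (map_poly h p) M)"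
  then have ij: "i < n" "j < n" using M by auto
  have hsum: "h (sum f A) = (\<Sum>k\<in>A. h (f k))" for f and A :: "nat set"
    by (induction A rule: infinite_finite_induct) (auto simp: h)
  have "(ext_mat M ^\<^sub>m k) $$ (i, j) = of_base ((M ^\<^sub>m k) $$ (i, j))" for k
  proof -
    have "dim_row (M ^\<^sub>m k) = n" "dim_col (M ^\<^sub>m k) = n"
      using M pow_carrier_mat[OF M, of k] by auto
    then show ?thesis using ij by (simp add: b.mat_hom_pow[OF M, symmetric])
  qed
  then show "map_mat h (poly_mat p (ext_mat M)) $$ (i, j) = poly_mat (map_poly h p) M $$ (i, j)"
    using M ij
    by (simp add: poly_mat_index[OF EM ij order_refl] hsum h coeff_map_poly
        poly_mat_index[OF M ij degree_map_poly_le])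
qed (use M in auto)

lemma parts_poly_mat:
  assumes M: "M \<in> carrier_mat n n"
  shows "map_mat re_part (poly_mat p (ext_mat M)) = poly_mat (map_poly re_part p) M"
    "map_mat im_part (poly_mat p (ext_mat M)) = poly_mat (map_poly im_part p) M"
  by (rule additive_part_poly_mat[OF M]; simp)+

lemma real_poly_mat:
  assumes M: "M \<in> carrier_mat n n"
    and real: "map_mat conj_i (poly_mat p (ext_mat M)) = poly_mat p (ext_mat M)"
  shows "poly_mat p (ext_mat M) = ext_mat (poly_mat (map_poly re_part p) M)"
proof -
  let ?A = "poly_mat p (ext_mat M)"
  have "?A = ext_mat (map_mat re_part ?A)"
  proof (rule eq_matI)
    fix i j assume "i < dim_row (ext_mat (map_mat re_part ?A))" "j < dim_col (ext_mat (map_mat re_part ?A))"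
    then have ij: "i < dim_row ?A" "j < dim_col ?A" by auto
    have "map_mat conj_i ?A $$ (i, j) = ?A $$ (i, j)" unfolding real ..
    then have "im_part (?A $$ (i, j)) = 0" using ij by (simp add: conj_i_eq_self_iff del: poly_mat_dim)
    then show "?A $$ (i, j) = ext_mat (map_mat re_part ?A) $$ (i, j)"
      using ij by (simp add: adjoin_i_eq_iff del: poly_mat_dim)
  qed auto
  then show ?thesis using parts_poly_mat(1)[OF M, of p] by simp
qed

text \<open>
  The minimal polynomial does not change under the extension of scalars: the real and the
  imaginary part of an annihilating polynomial annihilate \<open>M\<close> as well. Applied to the remainder
  modulo \<open>f\<close>, both parts vanish, because their degree is too small.
\<close>

lemma min_poly_dvd_ext:
  fixes M :: "'a::linordered_field mat"
  assumes M: "M \<in> carrier_mat n n" and min: "is_min_poly M f"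
    and p: "poly_mat p (ext_mat M) = 0\<^sub>m n n"
  shows "ext_poly f dvd p"
proof -
  interpret b: comm_ring_hom "of_base :: 'a \<Rightarrow> _" by (rule comm_ring_hom_of_base)
  have EM: "ext_mat M \<in> carrier_mat n n" using M by simp
  let ?f = "ext_poly f"
  have f1: "lead_coeff f = 1" and f0: "poly_mat f M = 0\<^sub>m n n"
    and minimal: "\<And>q. q \<noteq> 0 \<Longrightarrow> poly_mat q M = 0\<^sub>m n n \<Longrightarrow> degree f \<le> degree q"
    using min M by (auto simp: is_min_poly_def)
  have fE: "poly_mat ?f (ext_mat M) = 0\<^sub>m n n"
    using poly_mat_hom[OF comm_ring_hom_of_base M, of f] by (simp add: f0 map_mat_zero)
  have deg: "degree ?f = degree f" by (rule degree_map_poly) (auto simp: adjoin_i_eq_iff of_base_def adjoin_i_defs)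
  define q where "q = p mod ?f"
  have "coeff ?f (degree f) = 1" using f1 by (simp add: coeff_map_poly)
  then have "?f \<noteq> 0" by (metis coeff_0 zero_neq_one)
  have "q = p - p div ?f * ?f" by (simp add: q_def minus_div_mult_eq_mod)
  then have qE: "poly_mat q (ext_mat M) = 0\<^sub>m n n"
    using p fE EM by (simp add: poly_mat_diff[OF EM] poly_mat_mult[OF EM])
  have "map_poly h q = 0"
    if h: "map_mat h (poly_mat q (ext_mat M)) = poly_mat (map_poly h q) M" "h 0 = 0" for h :: "'a adjoin_i \<Rightarrow> 'a"
  proof (rule ccontr)
    assume nz: "map_poly h q \<noteq> 0"
    have "poly_mat (map_poly h q) M = 0\<^sub>m n n"
      unfolding h(1)[symmetric] qE using h(2) by auto
    from minimal[OF nz this] have "degree f \<le> degree q"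
      using degree_map_poly_le[of h q] by linarith
    moreover have "q \<noteq> 0" using nz h(2) by auto
    ultimately show False
      using degree_mod_less[OF \<open>?f \<noteq> 0\<close>, of p] deg by (auto simp: q_def)
  qed
  from this[OF parts_poly_mat(1)[OF M]] this[OF parts_poly_mat(2)[OF M]]
  have "map_poly re_part q = 0" "map_poly im_part q = 0" by simp_all
  then have "q = 0"
    by (auto simp: poly_eq_iff coeff_map_poly adjoin_i_eq_iff)
  then show ?thesis by (simp add: q_def mod_eq_0_iff_dvd)
qed

section \<open>The norm over a real closed field\<close>

text \<open>
  A root \<open>x + y \<surd>-1\<close> of \<open>X\<^sup>2 - c\<close> has \<open>x y = 0\<close> and \<open>x\<^sup>2 - y\<^sup>2 = c \<ge> 0\<close>, so its
  imaginary part is zero.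
\<close>

lemma real_closed_sqrt:
  fixes c :: "'a::linordered_field"
  assumes K: "real_closed TYPE('a)" and c: "0 \<le> c"
  obtains y where "0 \<le> y" "y\<^sup>2 = c"
proof -
  have "degree [:- of_base c, 0, 1:] = 2" by simp
  then obtain z where z: "poly [:- of_base c, 0, 1:] z = 0"
    using K unfolding real_closed_def by (metis zero_less_numeral)
  then have zz: "z * z = of_base c" by (simp add: algebra_simps)
  have re: "re_part z * re_part z - im_part z * im_part z = c"
    using arg_cong[OF zz, of re_part] by simp
  have im: "re_part z * im_part z = 0"
    using arg_cong[OF zz, of im_part] by (simp add: mult.commute)
  have "(re_part z)\<^sup>2 = c"
  proof (cases "im_part z = 0")
    case True
    then show ?thesis using re by (simp add: power2_eq_square)
  next
    case False
    then have "re_part z = 0" using im by simp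
    then have "c \<le> 0" using re zero_le_square[of "im_part z"] by auto
    then show ?thesis using c re False \<open>re_part z = 0\<close> by auto
  qed
  then show thesis using that[of "\<bar>re_part z\<bar>"] by simp
qed

context
  assumes K: "real_closed TYPE('a::linordered_field)"
begin

lemma norm_K: "0 \<le> norm_K z" "(norm_K z)\<^sup>2 = (re_part z)\<^sup>2 + (im_part z)\<^sup>2" for z :: "'a adjoin_i"
proof -
  obtain y where y: "0 \<le> y" "y\<^sup>2 = (re_part z)\<^sup>2 + (im_part z)\<^sup>2"
    using real_closed_sqrt[OF K, of "(re_part z)\<^sup>2 + (im_part z)\<^sup>2"] by auto
  have "0 \<le> norm_K z \<and> (norm_K z)\<^sup>2 = (re_part z)\<^sup>2 + (im_part z)\<^sup>2"
    unfolding norm_K_def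
    by (rule theI[of _ y]) (use y in \<open>auto intro: power2_eq_imp_eq\<close>)
  then show "0 \<le> norm_K z" "(norm_K z)\<^sup>2 = (re_part z)\<^sup>2 + (im_part z)\<^sup>2" by auto
qed

lemma norm_K_eqI: "0 \<le> y \<Longrightarrow> y\<^sup>2 = (re_part z)\<^sup>2 + (im_part z)\<^sup>2 \<Longrightarrow> norm_K z = y" for z :: "'a adjoin_i"
  using norm_K[of z] by (auto intro: power2_eq_imp_eq)

lemma norm_K_mult: "norm_K (x * y) = norm_K x * norm_K y" for x y :: "'a adjoin_i"
  by (rule norm_K_eqI) (simp_all add: norm_K power_mult_distrib, simp add: power2_eq_square algebra_simps)

lemma norm_K_of_base: "norm_K (of_base a) = \<bar>a\<bar>" for a :: 'a
  by (rule norm_K_eqI) simp_all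

lemma norm_K_conj: "norm_K (conj_i z) = norm_K z" for z :: "'a adjoin_i"
  by (rule norm_K_eqI) (simp_all add: norm_K)

lemma norm_K_eq_0_iff: "norm_K z = 0 \<longleftrightarrow> z = 0" for z :: "'a adjoin_i"
  using norm_K[of z] by (auto simp: adjoin_i_eq_iff sum_power2_eq_zero_iff intro: norm_K_eqI)

lemma norm_K_pos: "z \<noteq> 0 \<Longrightarrow> 0 < norm_K z" for z :: "'a adjoin_i"
  using norm_K(1)[of z] norm_K_eq_0_iff[of z] by simp

end

section \<open>The multiplicative decomposition\<close>

lemma pow_mat_mult_commuting:
  fixes A B :: "'k::comm_ring_1 mat"
  assumes A: "A \<in> carrier_mat n n" and B: "B \<in> carrier_mat n n" and AB: "A * B = B * A"
  shows "(A * B) ^\<^sub>m k = A ^\<^sub>m k * B ^\<^sub>m k"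
proof (induction k)
  case 0
  then show ?case using A B by simp
next
  case (Suc k)
  have "B ^\<^sub>m k * (A * B) = A * (B ^\<^sub>m k * B)"
    using A B pow_mat_commuting[OF B A AB[symmetric], of k]
    by (simp add: square_mat_algebra(1)[where n = n, symmetric])
  then show ?case using Suc A B by (simp add: square_mat_algebra[where n = n])
qed

lemma nilpotent_mult_commuting:
  fixes A B :: "'k::field mat"
  assumes A: "A \<in> carrier_mat n n" and B: "B \<in> carrier_mat n n" and AB: "A * B = B * A"
    and nil: "nilpotent_mat B"
  shows "nilpotent_mat (A * B)"
proof -
  obtain k where "B ^\<^sub>m k = 0\<^sub>m n n" using nil B by (auto simp: nilpotent_mat_def)
  then have "(A * B) ^\<^sub>m k = 0\<^sub>m n n"
    using right_mult_zero_mat[OF pow_carrier_mat[OF A, of k], of n]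
    by (simp add: pow_mat_mult_commuting[OF A B AB])
  then show ?thesis using A by (auto simp: nilpotent_mat_def)
qed

lemma ext_mat_mult:
  assumes "A \<in> carrier_mat n n" "B \<in> carrier_mat n n"
  shows "ext_mat (A * B) = ext_mat A * ext_mat B"
proof -
  interpret b: comm_ring_hom of_base by (rule comm_ring_hom_of_base)
  show ?thesis by (rule b.mat_hom_mult[OF assms])
qed

lemma ext_mat_one: "ext_mat (1\<^sub>m n) = 1\<^sub>m n"
  by (rule eq_matI) auto

lemma ext_mat_diff:
  assumes "A \<in> carrier_mat n n" "B \<in> carrier_mat n n"
  shows "ext_mat (A - B) = ext_mat A - ext_mat B"
  using assms by (intro eq_matI) (auto simp: adjoin_i_eq_iff)

lemma ext_mat_mat_diag: "ext_mat (mat_diag n d) = mat_diag n (\<lambda>j. of_base (d j))"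
  by (rule eq_matI) (auto simp: mat_diag_def)

lemma nilpotent_ext_mat_iff:
  assumes A: "A \<in> carrier_mat n n"
  shows "nilpotent_mat (ext_mat A) \<longleftrightarrow> nilpotent_mat A"
proof -
  interpret b: comm_ring_hom of_base by (rule comm_ring_hom_of_base)
  have "ext_mat A ^\<^sub>m k = 0\<^sub>m n n \<longleftrightarrow> A ^\<^sub>m k = 0\<^sub>m n n" for k
    using ext_mat_inj[of "A ^\<^sub>m k" "0\<^sub>m n n"]
    by (simp add: b.mat_hom_pow[OF A] map_mat_zero)
  then show ?thesis using A by (simp add: nilpotent_mat_def)
qed

lemma ext_inverse_pair:
  assumes "inverse_pair n P Q" shows "inverse_pair n (ext_mat P) (ext_mat Q)"
  using inverse_pairD[OF assms] unfolding inverse_pair_def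
  by (simp add: ext_mat_mult[of _ n, symmetric] ext_mat_one)

text \<open>
  The calculus of a matrix with entries in the ordered field. Nonreal points occur in conjugate
  pairs of equal multiplicity.
\<close>

locale conj_stable_idempotents =
  spectral_idempotents n "ext_mat M" I l \<mu> C
  for n and M :: "'a::linordered_field mat" and I :: "'i set" and l \<mu> C +
  assumes M: "M \<in> carrier_mat n n"
    and stable: "\<And>a. a \<in> I \<Longrightarrow> \<exists>b\<in>I. l a = conj_i (l b) \<and> \<mu> a = \<mu> b"
begin

text \<open>
  For a function \<open>g\<close> that commutes with conjugation, \<open>calc g\<close> has entries in the ordered
  field. Taking real parts of the coefficients exhibits it as a polynomial in \<open>M\<close> over that field.
\<close>

definition real_calc :: "('a adjoin_i \<Rightarrow> 'a adjoin_i) \<Rightarrow> 'a mat" where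
  "real_calc g = poly_mat (map_poly re_part (calc_poly g)) M"

lemma real_calc_carrier [simp]: "real_calc g \<in> carrier_mat n n"
  using M by (simp add: real_calc_def)

lemma ext_real_calc:
  assumes "\<And>z. g (conj_i z) = conj_i (g z)"
  shows "ext_mat (real_calc g) = calc g"
proof -
  have "map_mat conj_i (calc g) = calc g"
    by (rule map_calc[OF comm_ring_hom_conj_i map_mat_conj_ext stable]) (use assms in auto)
  then show ?thesis
    using real_poly_mat[OF M, of "calc_poly g"] by (simp add: calc_def real_calc_def)
qed

abbreviation (input) modulus :: "'a adjoin_i \<Rightarrow> 'a adjoin_i" where
  "modulus z \<equiv> of_base (norm_K z)"

abbreviation (input) phase :: "'a adjoin_i \<Rightarrow> 'a adjoin_i" where
  "phase z \<equiv> z / of_base (norm_K z)"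

context
  assumes K: "real_closed TYPE('a)"
    and nonzero: "\<forall>a\<in>I. l a \<noteq> 0"
begin

lemma nz: "a \<in> I \<Longrightarrow> l a \<noteq> 0"
  using nonzero by blast

lemma ext_modulus: "ext_mat (real_calc modulus) = calc modulus"
  by (rule ext_real_calc) (simp add: norm_K_conj[OF K])

lemma ext_phase: "ext_mat (real_calc phase) = calc phase"
  by (rule ext_real_calc) (simp add: norm_K_conj[OF K] conj_i_divide)

lemma ext_inverse: "ext_mat (real_calc inverse) = calc inverse"
  by (rule ext_real_calc) (simp add: conj_i_divide)

lemma of_base_norm_nz: "a \<in> I \<Longrightarrow> of_base (norm_K (l a)) \<noteq> 0"
  using nz[of a] norm_K_eq_0_iff[OF K, of "l a"] by (simp add: adjoin_i_eq_iff)

lemma modulus_mult_phase: "calc modulus * calc phase = calc (\<lambda>z. z)"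
  unfolding calc_mult by (rule calc_cong) (use of_base_norm_nz in simp)

lemma inverse_mult_calc: "calc inverse * calc (\<lambda>z. z) = 1\<^sub>m n" "calc (\<lambda>z. z) * calc inverse = 1\<^sub>m n"
  unfolding calc_mult calc_one[symmetric] by (rule calc_cong; use nz in simp)+

lemma inverse_mult_E: "calc inverse * ext_mat M = 1\<^sub>m n + calc inverse * (ext_mat M - calc (\<lambda>z. z))"
proof -
  have "calc inverse * (ext_mat M - calc (\<lambda>z. z)) = calc inverse * ext_mat M - 1\<^sub>m n"
    using E by (simp add: square_mat_algebra[where n = n] inverse_mult_calc)
  moreover have "1\<^sub>m n + (X - 1\<^sub>m n) = X" if "X \<in> carrier_mat n n" for X :: "'a adjoin_i mat"
    using that by (intro eq_matI) auto
  then have "1\<^sub>m n + (calc inverse * ext_mat M - 1\<^sub>m n) = calc inverse * ext_mat M"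
    using E by simp
  ultimately show ?thesis by simp
qed

text \<open>
  Diagonalizability over the ordered field itself needs a resolution of the identity there. The
  indicator functions of the circles \<open>|z| = x\<close> commute with conjugation, so their values are
  defined over the ordered field, and the modulus acts on the image of each as the scalar \<open>x\<close>.
\<close>

lemma diagonalized_modulus:
  obtains P Q d where "inverse_pair n P Q" "real_calc modulus = P * mat_diag n d * Q"
    "\<And>j. j < n \<Longrightarrow> 0 < d j"
proof -
  define X where "X = norm_K ` l ` I"
  define ind :: "'a \<Rightarrow> 'a adjoin_i \<Rightarrow> 'a adjoin_i" where "ind = (\<lambda>x z. if norm_K z = x then 1 else 0)"
  have ext_ind: "ext_mat (real_calc (ind x)) = calc (ind x)" for x
    by (rule ext_real_calc) (auto simp: ind_def norm_K_conj[OF K] adjoin_i_eq_iff)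
  have finX: "finite X" using fin by (simp add: X_def)
  have "ext_mat (mat_sum n (\<lambda>x. real_calc (ind x)) X) = mat_sum n (\<lambda>x. calc (ind x)) X"
  proof (rule eq_matI)
    fix i j assume "i < dim_row (mat_sum n (\<lambda>x. calc (ind x)) X)" "j < dim_col (mat_sum n (\<lambda>x. calc (ind x)) X)"
    then have ij: "i < n" "j < n" by auto
    interpret b: comm_ring_hom "of_base :: 'a \<Rightarrow> _" by (rule comm_ring_hom_of_base)
    have "of_base (real_calc (ind x) $$ (i, j)) = calc (ind x) $$ (i, j)" for x
      unfolding ext_ind[symmetric] using ij carrier_matD[OF real_calc_carrier[of "ind x"]] by simp
    then show "ext_mat (mat_sum n (\<lambda>x. real_calc (ind x)) X) $$ (i, j) = mat_sum n (\<lambda>x. calc (ind x)) X $$ (i, j)"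
      using ij by (simp add: b.hom_sum)
  qed auto
  also have "\<dots> = calc (\<lambda>z. 1)"
    unfolding calc_sum by (rule calc_cong) (use finX in \<open>simp add: ind_def X_def\<close>)
  finally have one: "mat_sum n (\<lambda>x. real_calc (ind x)) X = 1\<^sub>m n"
    by (simp add: calc_one ext_mat_inj flip: ext_mat_one)
  have scale: "real_calc modulus * real_calc (ind x) = x \<cdot>\<^sub>m real_calc (ind x)" for x
  proof -
    have "ext_mat (real_calc modulus * real_calc (ind x)) = calc (\<lambda>z. modulus z * ind x z)"
      by (simp add: ext_mat_mult[of _ n] ext_modulus ext_ind calc_mult)
    also have "\<dots> = calc (\<lambda>z. of_base x * ind x z)"
      by (rule calc_cong) (simp add: ind_def)
    also have "\<dots> = of_base x \<cdot>\<^sub>m ext_mat (real_calc (ind x))" by (simp add: calc_scale ext_ind)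
    also have "\<dots> = ext_mat (x \<cdot>\<^sub>m real_calc (ind x))"
      by (rule eq_matI) (auto simp: adjoin_i_eq_iff)
    finally show ?thesis by (simp add: ext_mat_inj)
  qed
  obtain P Q \<kappa> where *: "inverse_pair n P Q" "\<And>j. j < n \<Longrightarrow> \<kappa> j \<in> X"
    "\<And>A c. A \<in> carrier_mat n n \<Longrightarrow> (\<And>i. i \<in> X \<Longrightarrow> A * real_calc (ind i) = c i \<cdot>\<^sub>m real_calc (ind i)) \<Longrightarrow>
       A = P * mat_diag n (\<lambda>j. c (\<kappa> j)) * Q"
    by (rule diagonalize_resolution[OF finX real_calc_carrier one]) blast
  have "0 < \<kappa> j" if "j < n" for j
    using *(2)[OF that] nz norm_K_pos[OF K] by (auto simp: X_def)
  with that[OF *(1) *(3)[OF real_calc_carrier scale]] show thesis by simp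
qed

text \<open>
  The algebraic identities are those of the functions \<open>|z|\<close>, \<open>z / |z|\<close> and \<open>1 / z\<close>. The
  third factor is unipotent, because \<open>S\<^sup>-\<^sup>1 M - 1 = S\<^sup>-\<^sup>1 N\<close> is a product of commuting matrices of
  which \<open>N\<close> is nilpotent.
\<close>

lemma DSU_exists: "DSU_decomposition n M (real_calc modulus) (real_calc phase) (real_calc inverse * M)"
proof -
  let ?D = "real_calc modulus" and ?T = "real_calc phase" and ?V = "real_calc inverse"
  have U: "?V * M = poly_mat (map_poly re_part (calc_poly inverse) * [:0, 1:]) M"
    unfolding poly_mat_mult[OF M] using M by (simp add: real_calc_def)
  have "ext_mat (?D * ?T * (?V * M)) = calc (\<lambda>z. z) * (calc inverse * ext_mat M)"
    using M by (simp add: ext_mat_mult[of _ n] ext_modulus ext_phase ext_inverse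
        modulus_mult_phase[symmetric] square_mat_algebra[where n = n])
  also have "\<dots> = ext_mat M"
    using E by (simp add: square_mat_algebra(1)[where n = n, symmetric] inverse_mult_calc)
  finally have prod: "M = ?D * ?T * (?V * M)" by (simp add: ext_mat_inj)
  have com: "?D * ?T = ?T * ?D" "?D * (?V * M) = (?V * M) * ?D" "?T * (?V * M) = (?V * M) * ?T"
    unfolding U unfolding real_calc_def by (rule poly_mat_commute[OF M])+
  obtain P Q d where PQ: "inverse_pair n P Q" "?D = P * mat_diag n d * Q"
    and d: "\<And>j. j < n \<Longrightarrow> 0 < d j"
    by (rule diagonalized_modulus) blast
  have dD: "diagonalizable ?D" using PQ diagonalizable_iff[OF real_calc_carrier] by blast
  have eD: "\<forall>x. eigenvalue ?D x \<longrightarrow> 0 < x"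
    using d by (auto simp: eigenvalue_diagonalized[OF PQ])
  have eT: "norm_K z = 1" if ev: "eigenvalue (ext_mat ?T) z" for z
  proof -
    obtain a where a: "a \<in> I" "z = phase (l a)"
      using ev unfolding ext_phase by (rule eigenvalue_calc)
    have "norm_K z * norm_K (of_base (norm_K (l a))) = norm_K (l a)"
      unfolding norm_K_mult[OF K, symmetric] a(2) using of_base_norm_nz[OF a(1)] by simp
    then have "norm_K z * norm_K (l a) = norm_K (l a)"
      using norm_K(1)[OF K, of "l a"] by (simp add: norm_K_of_base[OF K])
    then show ?thesis using norm_K_eq_0_iff[OF K, of "l a"] nz[OF a(1)] by simp
  qed
  have "nilpotent_mat (ext_mat M - calc (\<lambda>z. z))"
    using jordan_chevalley_calc by (simp add: jordan_chevalley_def)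
  moreover have "calc inverse * (ext_mat M - calc (\<lambda>z. z)) = (ext_mat M - calc (\<lambda>z. z)) * calc inverse"
  proof -
    have "ext_mat M - calc (\<lambda>z. z) = poly_mat ([:0, 1:] - calc_poly (\<lambda>z. z)) (ext_mat M)"
      using E by (simp add: calc_def poly_mat_diff[OF E])
    then show ?thesis by (simp add: calc_def poly_mat_commute[OF E])
  qed
  ultimately have "nilpotent_mat (calc inverse * (ext_mat M - calc (\<lambda>z. z)))"
    using calc_carrier by (intro nilpotent_mult_commuting[of _ n]) (auto simp: minus_carrier_mat)
  moreover have "ext_mat (?V * M - 1\<^sub>m n) = calc inverse * (ext_mat M - calc (\<lambda>z. z))"
    using M E by (simp add: ext_mat_diff[of _ n] ext_mat_one ext_mat_mult[of _ n] ext_inverse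
        square_mat_algebra[where n = n] inverse_mult_calc)
  ultimately have "nilpotent_mat (?V * M - 1\<^sub>m n)"
    using nilpotent_ext_mat_iff[of "?V * M - 1\<^sub>m n" n] M by (simp add: minus_carrier_mat)
  then have uni: "unipotent_mat (?V * M)"
    using carrier_matD(1)[OF real_calc_carrier[of inverse]] by (simp add: unipotent_mat_def)
  have carr: "?D \<in> carrier_mat n n" "?T \<in> carrier_mat n n" "?V * M \<in> carrier_mat n n"
    using M by simp_all
  have dT: "diagonalizable (ext_mat ?T)" unfolding ext_phase by (rule diagonalizable_calc)
  have eT': "\<forall>z. eigenvalue (ext_mat ?T) z \<longrightarrow> norm_K z = 1" using eT by blast
  show ?thesis
    unfolding DSU_decomposition_def
    by (intro conjI; fact carr prod com dD eD dT eT' uni)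
qed

text \<open>
  The product \<open>D T\<close> is the semisimple part of \<open>M\<close> by uniqueness of the Jordan-Chevalley
  decomposition. In a common eigenbasis of \<open>D\<close> and \<open>T\<close>, with eigenvalues \<open>a\<^sub>j > 0\<close> and
  \<open>|b\<^sub>j| = 1\<close>, the calculus of \<open>M\<close> is \<open>g \<mapsto> g(a\<^sub>j b\<^sub>j)\<close>. Its values at the modulus and the
  phase are therefore \<open>a\<^sub>j\<close> and \<open>b\<^sub>j\<close>.
\<close>

lemma DSU_unique:
  assumes dec: "DSU_decomposition n M D T U"
  shows "ext_mat D = calc modulus" "ext_mat T = calc phase" "ext_mat U = calc inverse * ext_mat M"
proof -
  note alg = square_mat_algebra[where n = n]
  have D: "D \<in> carrier_mat n n" and T: "T \<in> carrier_mat n n" and U: "U \<in> carrier_mat n n"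
    and MDTU: "M = D * T * U" and com: "D * T = T * D" "D * U = U * D" "T * U = U * T"
    and dD: "diagonalizable D" and eD: "\<And>x. eigenvalue D x \<Longrightarrow> 0 < x"
    and dT: "diagonalizable (ext_mat T)" and eT: "\<And>z. eigenvalue (ext_mat T) z \<Longrightarrow> norm_K z = 1"
    and uU: "unipotent_mat U"
    using dec unfolding DSU_decomposition_def by blast+
  have ED: "ext_mat D \<in> carrier_mat n n" and ET: "ext_mat T \<in> carrier_mat n n"
    and EU: "ext_mat U \<in> carrier_mat n n" using D T U by simp_all
  obtain P0 Q0 d where PQ0: "inverse_pair n P0 Q0" "D = P0 * mat_diag n d * Q0"
    using dD by (auto simp: diagonalizable_iff[OF D])
  have EPQ0: "inverse_pair n (ext_mat P0) (ext_mat Q0)" by (rule ext_inverse_pair[OF PQ0(1)])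
  have EDd: "ext_mat D = ext_mat P0 * mat_diag n (\<lambda>j. of_base (d j)) * ext_mat Q0"
    unfolding PQ0(2) using inverse_pairD[OF PQ0(1)] by (simp add: ext_mat_mult[of _ n] ext_mat_mat_diag)
  have dED: "diagonalizable (ext_mat D)" using EPQ0 EDd diagonalizable_iff[OF ED] by blast
  have EDT: "ext_mat D * ext_mat T = ext_mat T * ext_mat D"
    using com(1) by (simp add: ext_mat_mult[OF D T, symmetric] ext_mat_mult[OF T D, symmetric])
  obtain P Q a b where PQ: "inverse_pair n P Q"
    and Da: "ext_mat D = P * mat_diag n a * Q" and Tb: "ext_mat T = P * mat_diag n b * Q"
    by (rule simultaneous_diagonalization[OF ED ET dED dT EDT])
  \<comment> \<open>The eigenvalues of \<open>D\<close> do not change under the extension of scalars, as \<open>D\<close> is diagonalizable over the small field.\<close>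
  have a: "\<exists>x>0. a j = of_base x" if j: "j < n" for j
  proof -
    have "eigenvalue (ext_mat D) (a j)" using j by (auto simp: eigenvalue_diagonalized[OF PQ Da])
    then obtain i where i: "i < n" "a j = of_base (d i)"
      by (auto simp: eigenvalue_diagonalized[OF EPQ0 EDd])
    moreover have "eigenvalue D (d i)" using i(1) by (auto simp: eigenvalue_diagonalized[OF PQ0])
    ultimately show ?thesis using eD by blast
  qed
  have b: "norm_K (b j) = 1" if j: "j < n" for j
    using j by (intro eT) (auto simp: eigenvalue_diagonalized[OF PQ Tb])
  define S where "S = ext_mat D * ext_mat T"
  have S: "S \<in> carrier_mat n n" using ED ET by (simp add: S_def)
  have Sab: "S = P * mat_diag n (\<lambda>j. a j * b j) * Q"
    unfolding S_def Da Tb conjugate_mult[OF PQ mat_diag_dim mat_diag_dim] by simp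
  have SU: "ext_mat M = S * ext_mat U"
    unfolding MDTU S_def using D T U by (simp add: ext_mat_mult[of _ n])
  have US: "S * ext_mat U = ext_mat U * S"
  proof -
    have "D * T * U = D * (T * U)" using D T U by (intro alg(1))
    also have "\<dots> = D * U * T" unfolding com(3) using D T U by (intro alg(1)[symmetric])
    also have "\<dots> = U * D * T" unfolding com(2) ..
    also have "\<dots> = U * (D * T)" using D T U by (simp add: alg)
    finally have "D * T * U = U * (D * T)" .
    then have "ext_mat (D * T * U) = ext_mat (U * (D * T))" by simp
    then show ?thesis unfolding S_def using D T U by (simp add: ext_mat_mult[of _ n])
  qed
  define W where "W = ext_mat U - 1\<^sub>m n"
  have W: "W \<in> carrier_mat n n" by (simp add: W_def minus_carrier_mat)
  have SW: "S * W = W * S" using US S EU by (simp add: W_def alg)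
  have "nilpotent_mat W"
  proof -
    have "nilpotent_mat (U - 1\<^sub>m n)" using uU U by (simp add: unipotent_mat_def)
    moreover have "ext_mat (U - 1\<^sub>m n) = W" unfolding W_def
      using U by (simp add: ext_mat_diff[of _ n] ext_mat_one)
    ultimately show ?thesis using nilpotent_ext_mat_iff[of "U - 1\<^sub>m n" n] by (simp add: minus_carrier_mat)
  qed
  then have "nilpotent_mat (S * W)" by (rule nilpotent_mult_commuting[OF S W SW])
  moreover have "S * (S * W) = S * W * S" using alg(1)[OF S W S] SW by simp
  moreover have "ext_mat M = S + S * W"
  proof -
    have "S * W = ext_mat M - S" unfolding SU W_def using S EU by (simp add: alg)
    then show ?thesis using S E carrier_matD[OF E] carrier_matD[OF S] by (auto intro!: eq_matI)
  qed
  moreover have "diagonalizable S" using PQ Sab diagonalizable_iff[OF S] by blast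
  ultimately have "jordan_chevalley (ext_mat M) S (S * W)"
    unfolding jordan_chevalley_def using S W E carrier_matD(1)[OF M] by simp
  then have S_calc: "S = calc (\<lambda>z. z)" using jordan_chevalley_iff by blast
  have calcg: "calc g = P * mat_diag n (\<lambda>j. g (a j * b j)) * Q" for g
    unfolding calc_eq_sum
    by (rule spectral_sum_diagonalized[OF PQ Sab spec_proj_carrier spec_proj_sum])
      (use calc_mult_spec_proj(2)[of _ "\<lambda>z. z"] S_calc in auto)
  have mod: "modulus (a j * b j) = a j" if j: "j < n" for j
  proof -
    obtain x where x: "0 < x" "a j = of_base x" using a[OF j] by blast
    then show ?thesis using b[OF j] by (simp add: norm_K_mult[OF K] norm_K_of_base[OF K])
  qed
  have ph: "phase (a j * b j) = b j" if j: "j < n" for j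
  proof -
    have "a j \<noteq> 0" using a[OF j] by (auto simp: adjoin_i_eq_iff)
    then show ?thesis unfolding mod[OF j] by simp
  qed
  have "mat_diag n (\<lambda>j. modulus (a j * b j)) = mat_diag n a"
    using mod by (auto simp: mat_diag_def intro!: eq_matI)
  then show "ext_mat D = calc modulus" unfolding Da calcg[of modulus] by simp
  have "mat_diag n (\<lambda>j. phase (a j * b j)) = mat_diag n b"
    using ph by (auto simp: mat_diag_def intro!: eq_matI)
  then show "ext_mat T = calc phase" unfolding Tb calcg[of phase] by simp
  have "calc inverse * ext_mat M = calc inverse * (S * ext_mat U)"
    by (rule arg_cong[OF SU])
  also have "\<dots> = calc inverse * S * ext_mat U"
    using S EU by (intro alg(1)[symmetric]) auto
  also have "calc inverse * S = 1\<^sub>m n" unfolding S_calc by (rule inverse_mult_calc)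
  finally show "ext_mat U = calc inverse * ext_mat M" using EU by simp
qed

lemma DSU_eq:
  assumes "DSU_decomposition n M D T U"
  shows "D = real_calc modulus" "T = real_calc phase" "U = real_calc inverse * M"
  using DSU_unique[OF assms] M
  by (simp_all add: ext_mat_inj[symmetric] ext_modulus ext_phase ext_inverse ext_mat_mult[of _ n])

lemma mat_inverse_calc: "invertible_mat (calc (\<lambda>z. z))" "mat_inverse (calc (\<lambda>z. z)) = Some (calc inverse)"
proof -
  let ?S = "calc (\<lambda>z. z)"
  have d: "dim_row (calc g) = n" "dim_col (calc g) = n" for g using carrier_matD[OF calc_carrier[of g]] by auto
  show "invertible_mat ?S"
    unfolding invertible_mat_def inverts_mat_def using inverse_mult_calc d
    by (auto intro!: exI[of _ "calc inverse"])
  have "?S \<in> Units (ring_mat TYPE('a adjoin_i) n ())"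
    unfolding Units_def ring_mat_def using inverse_mult_calc by (auto intro!: bexI[of _ "calc inverse"])
  then obtain B where B: "mat_inverse ?S = Some B"
    using mat_inverse(1)[OF calc_carrier, of "\<lambda>z. z" "()"] by fastforce
  from mat_inverse(2)[OF calc_carrier B] have BS: "?S * B = 1\<^sub>m n" "B \<in> carrier_mat n n" by auto
  have "B = calc inverse * ?S * B" using BS by (simp add: inverse_mult_calc)
  also have "\<dots> = calc inverse" using BS by (simp add: square_mat_algebra[where n = n] right_mult_one_mat[OF calc_carrier])
  finally show "mat_inverse ?S = Some (calc inverse)" using B by simp
qed

end

end

section \<open>Primary decomposition over a real closed field\<close>

lemma mat_sum_Un:
  assumes "finite A" "finite B" "A \<inter> B = {}"
  shows "mat_sum n F (A \<union> B) = mat_sum n F A + mat_sum n F B"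
  by (rule eq_matI) (use assms in \<open>auto simp: sum.union_disjoint\<close>)

lemma mat_sum_pairs:
  assumes F: "\<And>a. F a \<in> carrier_mat n n"
  shows "mat_sum n F ({1..s} \<times> {1, 2 :: nat} \<union> {s + 1..r} \<times> {1}) =
    mat_sum n (\<lambda>h. F (h, 1) + F (h, 2)) {1..s} + mat_sum n (\<lambda>i. F (i, 1)) {s + 1..r :: nat}"
    (is "mat_sum n F (?A \<union> ?B) = _")
proof -
  have d: "dim_row (F a) = n" "dim_col (F a) = n" for a using F[of a] by auto
  have "(\<Sum>a\<in>?A. F a $$ (i, j)) = (\<Sum>h=1..s. \<Sum>k\<in>{1, 2}. F (h, k) $$ (i, j))"
    "(\<Sum>a\<in>?B. F a $$ (i, j)) = (\<Sum>h=s+1..r. \<Sum>k\<in>{1}. F (h, k) $$ (i, j))" for i j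
    by (simp_all only: sum.cartesian_product')
  then have "mat_sum n F ?A = mat_sum n (\<lambda>h. F (h, 1) + F (h, 2)) {1..s}"
    "mat_sum n F ?B = mat_sum n (\<lambda>i. F (i, 1)) {s + 1..r}"
    by (auto intro!: eq_matI simp: d)
  then show ?thesis by (subst mat_sum_Un) auto
qed

text \<open>
  Separates the positive from the negative real eigenvalues in the formulas for \<open>S\<close> and \<open>\<Sigma>\<close>.
\<close>

lemma mat_sum_signs:
  fixes F H :: "nat \<Rightarrow> 'k::ring_1 mat"
  assumes H: "\<And>i. H i \<in> carrier_mat n n" and p: "p \<le> r"
    and pos: "\<And>i. i \<in> {s + 1..p} \<Longrightarrow> F i = H i" and neg: "\<And>i. i \<in> {p + 1..r} \<Longrightarrow> F i = - H i"
    and s: "s \<le> p"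
  shows "mat_sum n F {s + 1..r} = mat_sum n H {s + 1..p} - mat_sum n H {p + 1..r}"
proof (rule eq_matI)
  fix i j assume "i < dim_row (mat_sum n H {s + 1..p} - mat_sum n H {p + 1..r})"
    "j < dim_col (mat_sum n H {s + 1..p} - mat_sum n H {p + 1..r})"
  then have ij: "i < n" "j < n" by auto
  have d: "dim_row (H k) = n" "dim_col (H k) = n" for k using H[of k] by auto
  have "{s + 1..r} = {s + 1..p} \<union> {p + 1..r}" using s p by auto
  then have "(\<Sum>k=s+1..r. F k $$ (i, j)) = (\<Sum>k=s+1..p. F k $$ (i, j)) + (\<Sum>k=p+1..r. F k $$ (i, j))"
    by (simp add: sum.union_disjoint)
  also have "(\<Sum>k=p+1..r. F k $$ (i, j)) = - (\<Sum>k=p+1..r. H k $$ (i, j))"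
    unfolding sum_negf[symmetric] using neg ij d by (intro sum.cong) auto
  also have "(\<Sum>k=s+1..p. F k $$ (i, j)) = (\<Sum>k=s+1..p. H k $$ (i, j))"
    using pos by (intro sum.cong) auto
  finally show "mat_sum n F {s + 1..r} $$ (i, j) =
      (mat_sum n H {s + 1..p} - mat_sum n H {p + 1..r}) $$ (i, j)" using ij by simp
qed auto

lemma ext_poly_inj: "ext_poly p = ext_poly q \<longleftrightarrow> p = q"
  by (auto simp: poly_eq_iff coeff_map_poly)

lemma singular_imp_eigenvalue_0:
  fixes M :: "'k::field mat"
  assumes M: "M \<in> carrier_mat n n" and sing: "\<not> invertible_mat M"
  shows "eigenvalue M 0"
proof -
  have "det M = 0"
  proof (rule ccontr)
    assume "det M \<noteq> 0"
    from det_non_zero_imp_unit[OF M this, of "()"] obtain N where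
      "N \<in> carrier_mat n n" "M * N = 1\<^sub>m n" "N * M = 1\<^sub>m n"
      by (auto simp: Units_def ring_mat_def)
    then have "invertible_mat M"
      using M unfolding invertible_mat_def inverts_mat_def by auto
    then show False using sing by simp
  qed
  moreover have "char_matrix M 0 = M" using M by (intro eq_matI) (auto simp: char_matrix_def)
  ultimately show ?thesis by (simp add: eigenvalue_det[OF M])
qed

theorem proposition4p2:
  fixes M :: "'a::linordered_field mat"
    and n r r' s1 s2 :: nat
    and m :: "nat \<Rightarrow> 'a poly"
    and \<mu> :: "nat \<Rightarrow> nat"
    and l :: "nat \<Rightarrow> nat \<Rightarrow> 'a adjoin_i"
    and \<gamma> :: "nat \<Rightarrow> 'a"
    and B G C :: "nat \<Rightarrow> nat \<Rightarrow> 'a adjoin_i poly"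
  assumes K: "real_closed TYPE('a)"
    and n: "0 < n"
    and M: "M \<in> carrier_mat n n"
    and min_poly: "is_min_poly M (\<Prod>i=1..r. m i ^ \<mu> i)"
    and mult_pos: "\<forall>i\<in>{1..r}. 0 < \<mu> i"
    and factors: "\<forall>i\<in>{1..r}. lead_coeff (m i) = 1 \<and> irreducible (m i)"
    and distinct: "inj_on m {1..r}"
    and zero_last: "eigenvalue M 0 \<longrightarrow> m r = [:0, 1:]"
    and r': "r' = (if invertible_mat M then r else r - 1)"
    and s_le: "s1 + s2 \<le> r'"
    and roots: "\<forall>i\<in>{1..r}. ext_poly (m i) = (\<Prod>j=1..degree (m i). [:- l i j, 1:])"
    and quadratic: "\<forall>h\<in>{1..s1}. degree (m h) = 2 \<and> l h 1 \<notin> range of_base \<and> l h 2 = conj_i (l h 1)"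
    and positive: "\<forall>i\<in>{s1+1..s1+s2}. degree (m i) = 1 \<and> l i 1 = of_base (\<gamma> i) \<and> 0 < \<gamma> i"
    and negative: "\<forall>i\<in>{s1+s2+1..r'}. degree (m i) = 1 \<and> l i 1 = of_base (- \<gamma> i) \<and> - \<gamma> i < 0"
    and G: "\<forall>i\<in>{1..r}. \<forall>j\<in>{1..degree (m i)}.
              G i j = ext_poly (\<Prod>k=1..r. m k ^ \<mu> k) div [:- l i j, 1:] ^ \<mu> i"
    and B_coeffs: "\<forall>i\<in>{1..r}. \<forall>j\<in>{1..degree (m i)}. \<forall>k.
              coeff (B i j) k \<in> adjoin (l i ` {1..degree (m i)})"
    and B_degree: "\<forall>i\<in>{1..r}. \<forall>j\<in>{1..degree (m i)}. degree (B i j) < \<mu> i"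
    and B_sum: "(\<Sum>i=1..r. \<Sum>j=1..degree (m i). B i j * G i j) = 1"
    and C: "\<forall>i\<in>{1..r}. \<forall>j\<in>{1..degree (m i)}. C i j = B i j * G i j"
  shows
    "(ss_part M \<noteq> 0\<^sub>m n n \<longrightarrow>
        ss_part M =
            mat_sum n (\<lambda>h. l h 1 \<cdot>\<^sub>m poly_mat (C h 1) (ext_mat M)
                         + conj_i (l h 1) \<cdot>\<^sub>m poly_mat (C h 2) (ext_mat M)) {1..s1}
          + mat_sum n (\<lambda>i. of_base (\<gamma> i) \<cdot>\<^sub>m poly_mat (C i 1) (ext_mat M)) {s1+1..s1+s2}
          - mat_sum n (\<lambda>i. of_base (\<gamma> i) \<cdot>\<^sub>m poly_mat (C i 1) (ext_mat M)) {s1+s2+1..r'}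
      \<and> frobenius_decomposition n (ss_part M)
          ({1..s1} \<times> {1, 2} \<union> {s1+1..r'} \<times> {1})
          (\<lambda>(i, j). l i j) (\<lambda>(i, j). poly_mat (C i j) (ext_mat M))
      \<and> (\<forall>i\<in>{s1+1..r'}. 0 < \<gamma> i)
      \<and> (\<forall>h\<in>{1..s1}. l h 1 \<notin> range of_base \<and>
            poly_mat (C h 2) (ext_mat M) = map_mat conj_i (poly_mat (C h 1) (ext_mat M))))
   \<and> (invertible_mat M \<longrightarrow>
        (\<exists>!(DSU :: 'a mat \<times> 'a mat \<times> 'a mat).
            case DSU of (\<Delta>, \<Sigma>, U) \<Rightarrow> DSU_decomposition n M \<Delta> \<Sigma> U)
      \<and> (\<forall>\<Delta> \<Sigma> U. DSU_decomposition n M \<Delta> \<Sigma> U \<longrightarrow>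
            ext_mat \<Delta> =
                mat_sum n (\<lambda>h. of_base (norm_K (l h 1)) \<cdot>\<^sub>m
                    (poly_mat (C h 1) (ext_mat M) + poly_mat (C h 2) (ext_mat M))) {1..s1}
              + mat_sum n (\<lambda>i. of_base (\<gamma> i) \<cdot>\<^sub>m poly_mat (C i 1) (ext_mat M)) {s1+1..r'}
          \<and> ext_mat \<Sigma> =
                mat_sum n (\<lambda>h. (l h 1 / of_base (norm_K (l h 1))) \<cdot>\<^sub>m poly_mat (C h 1) (ext_mat M)
                    + (conj_i (l h 1) / of_base (norm_K (l h 1))) \<cdot>\<^sub>m poly_mat (C h 2) (ext_mat M)) {1..s1}
              + mat_sum n (\<lambda>i. poly_mat (C i 1) (ext_mat M)) {s1+1..s1+s2}
              - mat_sum n (\<lambda>i. poly_mat (C i 1) (ext_mat M)) {s1+s2+1..r'}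
          \<and> ss_part M = ext_mat \<Delta> * ext_mat \<Sigma>
          \<and> invertible_mat (ss_part M)
          \<and> ext_mat U = 1\<^sub>m n + the (mat_inverse (ss_part M)) * nil_part M
          \<and> (\<exists>p q u :: 'a poly. \<Delta> = poly_mat p M \<and> \<Sigma> = poly_mat q M \<and> U = poly_mat u M)))"
proof -
  define f where "f = (\<Prod>k=1..r. m k ^ \<mu> k)"
  define I where "I = (SIGMA i:{1..r}. {1..degree (m i)})"
  define J where "J = {1..s1} \<times> {1, 2} \<union> {s1+1..r'} \<times> {1::nat}"
  define L where "L = (\<lambda>(i, j). l i j)"
  define \<nu> where "\<nu> = (\<lambda>(i, j :: nat). \<mu> i)"
  define D where "D = (\<lambda>(i, j). C i j)"
  define q where "q = (\<lambda>a. [:- L a, 1:] ^ \<nu> a)"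
  have L [simp]: "L (i, j) = l i j" and D [simp]: "D (i, j) = C i j"
    and nu [simp]: "\<nu> (i, j) = \<mu> i" for i j
    by (simp_all add: L_def D_def \<nu>_def)
  have finI: "finite I" by (simp add: I_def)
  have q0: "q a \<noteq> 0" for a by (simp add: q_def)
  have r1: "1 \<le> r"
  proof (rule ccontr)
    assume "\<not> 1 \<le> r"
    then show False using B_sum by simp
  qed
  have sing: "r' = r - 1 \<and> m r = [:0, 1:]" if "\<not> invertible_mat M"
    using that r' zero_last singular_imp_eigenvalue_0[OF M] by simp
  have r'_le: "r' \<le> r" using r' by (simp split: if_splits)
  have roots1: "ext_poly (m i) = [:- l i 1, 1:]" if "i \<in> {1..r}" "degree (m i) = 1" for i
    using roots[rule_format, OF that(1)] that(2) by simp
  have last0: "degree (m r) = 1" "l r 1 = 0" if "\<not> invertible_mat M"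
  proof -
    show "degree (m r) = 1" using sing[OF that] by simp
    then show "l r 1 = 0"
      using roots1[of r] r1 sing[OF that] by (simp add: map_poly_pCons)
  qed
  have J_cases: thesis
    if "a \<in> J" "\<And>h. h \<in> {1..s1} \<Longrightarrow> a = (h, 1) \<or> a = (h, 2) \<Longrightarrow> thesis"
      "\<And>i. i \<in> {s1+1..s1+s2} \<Longrightarrow> a = (i, 1) \<Longrightarrow> thesis"
      "\<And>i. i \<in> {s1+s2+1..r'} \<Longrightarrow> a = (i, 1) \<Longrightarrow> thesis" for a thesis
  proof -
    from that(1) consider h where "h \<in> {1..s1}" "a = (h, 1) \<or> a = (h, 2)"
      | i where "i \<in> {s1+1..r'}" "a = (i, 1)" by (auto simp: J_def)
    then show thesis
    proof cases
      case (2 i)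
      then show thesis using that(3)[of i] that(4)[of i] by (cases "i \<le> s1 + s2") auto
    qed (use that in blast)
  qed
  have degJ: "degree (m i) = 1" if "i \<in> {s1+1..r'}" for i
    using that positive negative by (cases "i \<le> s1 + s2") auto
  \<comment> \<open>\<open>J\<close> indexes the nonzero eigenvalues; a singular \<open>M\<close> has the additional eigenvalue \<open>0\<close>, with the last index \<open>r\<close>.\<close>
  have IJ: "I = J \<union> (if invertible_mat M then {} else {(r, 1)})"
  proof -
    have "(i, j) \<in> I \<longleftrightarrow> (i, j) \<in> J \<union> (if invertible_mat M then {} else {(r, 1)})" for i j
    proof -
      consider "i \<notin> {1..r}" | "i \<in> {1..s1}" | "i \<in> {s1+1..r'}" | "i = r" "r' < r"
        using s_le r'_le r' by (fastforce split: if_splits)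
      then show ?thesis
      proof cases
        case 1
        then show ?thesis using s_le r'_le r1 by (auto simp: I_def J_def split: if_splits)
      next
        case 2
        then have "degree (m i) = 2" using quadratic by blast
        then show ?thesis using 2 s_le r'_le r' r1 by (auto simp: I_def J_def split: if_splits)
      next
        case 3
        then show ?thesis using degJ[OF 3] r'_le r' r1 by (auto simp: I_def J_def split: if_splits)
      next
        case 4
        then have ni: "\<not> invertible_mat M" using r' by auto
        then show ?thesis using 4 last0(1) r1 s_le by (auto simp: I_def J_def)
      qed
    qed
    then show ?thesis by (auto simp: set_eq_iff simp del: Un_iff)
  qed
  have L_tail: "L a = 0" if "a \<in> I - J" for a
    using that last0(2) unfolding IJ by (auto split: if_splits)
  have JI: "J \<subseteq> I" unfolding IJ by blast

  have ext_f: "ext_poly f = (\<Prod>a\<in>I. q a)"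
  proof -
    interpret b: comm_ring_hom "of_base :: 'a \<Rightarrow> _" by (rule comm_ring_hom_of_base)
    interpret mp: map_poly_comm_ring_hom "of_base :: 'a \<Rightarrow> _" ..
    have "ext_poly f = (\<Prod>k=1..r. ext_poly (m k) ^ \<mu> k)"
      by (simp add: f_def mp.hom_prod mp.hom_power)
    also have "\<dots> = (\<Prod>k=1..r. \<Prod>j=1..degree (m k). q (k, j))"
    proof (rule prod.cong[OF refl])
      fix k assume "k \<in> {1..r}"
      then have e: "ext_poly (m k) = (\<Prod>j=1..degree (m k). [:- l k j, 1:])" using roots by blast
      show "ext_poly (m k) ^ \<mu> k = (\<Prod>j=1..degree (m k). q (k, j))"
        unfolding e by (simp add: q_def prod_power_distrib)
    qed
    also have "\<dots> = (\<Prod>a\<in>I. q a)" unfolding I_def by (subst prod.Sigma) auto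
    finally show ?thesis .
  qed
  have GI: "G i j = (\<Prod>b\<in>I - {(i, j)}. q b)" if a: "(i, j) \<in> I" for i j
  proof -
    have "G i j = ext_poly f div q (i, j)"
      using a G by (simp add: I_def f_def q_def)
    also have "ext_poly f = q (i, j) * (\<Prod>b\<in>I - {(i, j)}. q b)"
      unfolding ext_f by (rule prod.remove[OF finI a])
    finally show ?thesis using q0 by simp
  qed
  have CI: "C i j = B i j * G i j" if "(i, j) \<in> I" for i j
    using that C by (simp add: I_def)
  \<comment> \<open>\<open>G\<close> at \<open>b\<close> is the product of all powers but the one at \<open>b\<close>, so every other power divides \<open>D b\<close>.\<close>
  have other: "q a dvd D b" if "a \<in> I" "b \<in> I" "a \<noteq> b" for a b
  proof -
    obtain i j where b: "b = (i, j)" by (cases b)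
    have "q a dvd G i j" using that finI GI[of i j] unfolding b by (auto intro!: dvd_prodI)
    then show ?thesis using CI[of i j] that unfolding b by simp
  qed
  have sumD: "(\<Sum>a\<in>I. D a) = 1"
  proof -
    have "(\<Sum>a\<in>I. D a) = (\<Sum>i=1..r. \<Sum>j=1..degree (m i). D (i, j))"
      unfolding I_def by (subst sum.Sigma) (auto simp: D_def intro!: sum.cong)
    also have "\<dots> = (\<Sum>i=1..r. \<Sum>j=1..degree (m i). B i j * G i j)"
      using C by (intro sum.cong) auto
    finally show ?thesis using B_sum by simp
  qed
  have E: "ext_mat M \<in> carrier_mat n n" using M by simp
  have f0: "poly_mat (ext_poly f) (ext_mat M) = 0\<^sub>m n n"
    using poly_mat_hom[OF comm_ring_hom_of_base M, of f] min_poly M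
    by (simp add: is_min_poly_def f_def map_mat_zero)
  have vanish: "poly_mat p (ext_mat M) = 0\<^sub>m n n" if dv: "\<And>a. a \<in> I \<Longrightarrow> q a dvd p" for p
  proof -
    have "ext_poly f dvd p * D a" if a: "a \<in> I" for a
    proof -
      obtain i j where ij: "a = (i, j)" by (cases a)
      have "ext_poly f = q a * G i j"
        using prod.remove[OF finI a, of q] GI[of i j] a unfolding ext_f ij by simp
      moreover have "D a = B i j * G i j" using CI[of i j] a unfolding ij by simp
      moreover have "q a * G i j dvd p * (B i j * G i j)"
        using dv[OF a] by (metis dvd_refl dvd_mult2 mult.assoc mult_dvd_mono)
      ultimately show ?thesis by simp
    qed
    then have "ext_poly f dvd (\<Sum>a\<in>I. p * D a)" by (rule dvd_sum)
    then have "ext_poly f dvd p" unfolding sum_distrib_left[symmetric] sumD by simp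
    then obtain k where k: "p = ext_poly f * k" by (auto simp: dvd_def)
    show ?thesis unfolding k using poly_mat_carrier[OF E, of k]
      by (simp add: poly_mat_mult[OF E] f0 left_mult_zero_mat[of _ n n])
  qed

  \<comment> \<open>Roots with index in \<open>J\<close> are nonzero; they are nonreal in conjugate pairs, or real of the prescribed sign.\<close>
  have realJ: "im_part (l i 1) = 0" "l i 1 = of_base (\<gamma> i) \<or> l i 1 = of_base (- \<gamma> i)" "0 < \<gamma> i"
    if "i \<in> {s1+1..r'}" for i
    using that positive[rule_format, of i] negative[rule_format, of i]
    by (cases "i \<le> s1 + s2"; auto)+
  have complexJ: "im_part (l h 1) \<noteq> 0" "l h 2 = conj_i (l h 1)" "degree (m h) = 2" if "h \<in> {1..s1}" for h
    using that quadratic[rule_format, of h] by (auto simp: in_range_of_base_iff)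
  have stable: "\<exists>b\<in>I. L a = conj_i (L b) \<and> \<nu> a = \<nu> b" if a: "a \<in> I" for a
  proof (cases "a \<in> J")
    case True
    then show ?thesis
    proof (rule J_cases)
      fix h assume h: "h \<in> {1..s1}" "a = (h, 1) \<or> a = (h, 2)"
      then have "(h, 1) \<in> I" "(h, 2) \<in> I" using JI by (auto simp: J_def)
      with h complexJ(2)[OF h(1)] show ?thesis
        by (elim disjE) (auto intro: bexI[of _ "(h, 1)"] bexI[of _ "(h, 2)"])
    qed (use realJ(1) a s_le in \<open>auto simp: conj_i_eq_self_iff[THEN iffD2] intro!: bexI[of _ a]\<close>)
  next
    case False
    then have "L a = 0" using L_tail a by blast
    then show ?thesis using a by (intro bexI[of _ a]) (auto simp: adjoin_i_eq_iff)
  qed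
  \<comment> \<open>A root determines its irreducible factor over the ordered field, so different factors share no root.\<close>
  define factor :: "'a adjoin_i \<Rightarrow> 'a adjoin_i poly" where
    "factor = (\<lambda>z. if im_part z = 0 then [:- z, 1:] else [:- z, 1:] * [:- conj_i z, 1:])"
  have factor: "ext_poly (m i) = factor (l i j)" if a: "(i, j) \<in> I" for i j
  proof (cases "(i, j) \<in> J")
    case True
    then consider "i \<in> {1..s1}" "j = 1 \<or> j = 2" | "i \<in> {s1+1..r'}" "j = 1" by (auto simp: J_def)
    then show ?thesis
    proof cases
      case 1
      have "{1..2::nat} = {1, 2}" by auto
      then have "ext_poly (m i) = [:- l i 1, 1:] * [:- l i 2, 1:]"
        using roots a complexJ(3)[OF 1(1)] by (simp add: I_def)
      then show ?thesis using 1(2) complexJ[OF 1(1)] by (auto simp: factor_def mult.commute)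
    next
      case 2
      then show ?thesis
        using roots1[of i] degJ[OF 2(1)] realJ(1)[OF 2(1)] a by (simp add: factor_def I_def)
    qed
  next
    case False
    then have "i = r" "j = 1" "\<not> invertible_mat M" using a unfolding IJ by (auto split: if_splits)
    then show ?thesis using roots1[of r] last0 r1 by (simp add: factor_def)
  qed
  have inj: "inj_on L I"
  proof (rule inj_onI)
    fix a b assume ab: "a \<in> I" "b \<in> I" "L a = L b"
    obtain i j i' j' where e: "a = (i, j)" "b = (i', j')" by (cases a, cases b)
    have "ext_poly (m i) = ext_poly (m i')" using factor ab unfolding e by simp
    then have "m i = m i'" by (simp add: ext_poly_inj)
    then have ii: "i = i'" using distinct ab unfolding e I_def by (auto dest: inj_onD)
    have "j = j'"
    proof (cases "i \<in> {1..s1}")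
      case True
      then have "l i 1 \<noteq> l i 2" using complexJ[OF True] by (auto simp: adjoin_i_eq_iff)
      moreover have "j = 1 \<or> j = 2" "j' = 1 \<or> j' = 2"
        using ab complexJ(3)[OF True] unfolding e ii by (auto simp: I_def ii)
      ultimately show ?thesis using ab(3) unfolding e ii by auto
    next
      case False
      then have "j = 1" "j' = 1" using ab unfolding e ii IJ J_def by (auto split: if_splits)
      then show ?thesis by simp
    qed
    then show "a = b" using e ii by simp
  qed
  have LJ_nz: "L a \<noteq> 0" if "a \<in> J" for a
    using that
  proof (rule J_cases)
    fix h assume h: "h \<in> {1..s1}" "a = (h, 1) \<or> a = (h, 2)"
    then show ?thesis using complexJ[OF h(1)] by (auto simp: adjoin_i_eq_iff)
  next
    fix i assume "i \<in> {s1+1..s1+s2}" "a = (i, 1)"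
    then show ?thesis using positive[rule_format, of i] by (auto simp: adjoin_i_eq_iff)
  next
    fix i assume "i \<in> {s1+s2+1..r'}" "a = (i, 1)"
    then show ?thesis using negative[rule_format, of i] by (auto simp: adjoin_i_eq_iff)
  qed

  interpret conj_stable_idempotents n M I L \<nu> D
  proof unfold_locales
    show "0 < \<nu> a" if "a \<in> I" for a using that mult_pos by (auto simp: I_def)
  qed (use E finI other sumD vanish M stable in \<open>auto simp: q_def\<close>)

  have ss: "ss_part M = calc (\<lambda>z. z)"
    unfolding ss_part_def
    by (rule the_equality) (use jordan_chevalley_calc jordan_chevalley_iff in blast)+
  have np: "nil_part M = ext_mat M - calc (\<lambda>z. z)"
    unfolding nil_part_def
    by (rule the_equality) (use jordan_chevalley_calc jordan_chevalley_iff in blast)+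
  have dZ [simp]: "dim_row (spec_proj a) = n" "dim_col (spec_proj a) = n" for a
    using carrier_matD[OF spec_proj_carrier[of a]] by auto
  have ZC: "poly_mat (C i j) (ext_mat M) = spec_proj (i, j)" for i j by simp
  \<comment> \<open>The eigenvalue \<open>0\<close> drops out when \<open>g 0 = 0\<close>; this covers the formula for the semisimple part of a singular \<open>M\<close>.\<close>
  have calc_J: "calc g = mat_sum n (\<lambda>a. g (L a) \<cdot>\<^sub>m spec_proj a) J" if g: "\<not> invertible_mat M \<Longrightarrow> g 0 = 0" for g
    unfolding calc_eq_sum
  proof (rule eq_matI)
    fix i j assume "i < dim_row (mat_sum n (\<lambda>a. g (L a) \<cdot>\<^sub>m spec_proj a) J)"
      "j < dim_col (mat_sum n (\<lambda>a. g (L a) \<cdot>\<^sub>m spec_proj a) J)"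
    then have ij: "i < n" "j < n" by auto
    have "g (L a) = 0" if "a \<in> I - J" for a
      using that g L_tail[OF that] unfolding IJ by (auto split: if_splits)
    then have "(\<Sum>a\<in>I. g (L a) * spec_proj a $$ (i, j)) = (\<Sum>a\<in>J. g (L a) * spec_proj a $$ (i, j))"
      by (intro sum.mono_neutral_right finI JI) auto
    then show "mat_sum n (\<lambda>a. g (L a) \<cdot>\<^sub>m spec_proj a) I $$ (i, j) = mat_sum n (\<lambda>a. g (L a) \<cdot>\<^sub>m spec_proj a) J $$ (i, j)"
      using ij by (simp del: poly_mat_dim)
  qed auto
  have calc_split: "calc g = mat_sum n (\<lambda>h. g (l h 1) \<cdot>\<^sub>m poly_mat (C h 1) (ext_mat M)
        + g (conj_i (l h 1)) \<cdot>\<^sub>m poly_mat (C h 2) (ext_mat M)) {1..s1}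
      + mat_sum n (\<lambda>i. g (l i 1) \<cdot>\<^sub>m poly_mat (C i 1) (ext_mat M)) {s1+1..r'}"
    if g: "\<not> invertible_mat M \<Longrightarrow> g 0 = 0" for g
  proof -
    have "calc g = mat_sum n (\<lambda>h. g (L (h, 1)) \<cdot>\<^sub>m spec_proj (h, 1) + g (L (h, 2)) \<cdot>\<^sub>m spec_proj (h, 2)) {1..s1}
        + mat_sum n (\<lambda>i. g (L (i, 1)) \<cdot>\<^sub>m spec_proj (i, 1)) {s1+1..r'}"
      by (rule trans[OF calc_J[of g, OF g, unfolded J_def] mat_sum_pairs]) (use E in auto)
    also have "mat_sum n (\<lambda>h. g (L (h, 1)) \<cdot>\<^sub>m spec_proj (h, 1) + g (L (h, 2)) \<cdot>\<^sub>m spec_proj (h, 2)) {1..s1} =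
        mat_sum n (\<lambda>h. g (l h 1) \<cdot>\<^sub>m poly_mat (C h 1) (ext_mat M)
          + g (conj_i (l h 1)) \<cdot>\<^sub>m poly_mat (C h 2) (ext_mat M)) {1..s1}"
      by (rule mat_sum_cong) (simp add: complexJ(2))
    finally show ?thesis by simp
  qed
  have gamma_pos: "\<forall>i\<in>{s1+1..r'}. 0 < \<gamma> i" using realJ(3) by blast
  have conjC: "poly_mat (C h 2) (ext_mat M) = map_mat conj_i (poly_mat (C h 1) (ext_mat M))"
    if h: "h \<in> {1..s1}" for h
  proof -
    have hI: "(h, 1) \<in> I" "(h, 2) \<in> I" using h JI by (auto simp: J_def)
    have "map_mat conj_i (spec_proj (h, 1)) = spec_proj (h, 2)"
      unfolding spec_proj_eq_calc[OF inj hI(1)] spec_proj_eq_calc[OF inj hI(2)]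
      by (rule map_calc[OF comm_ring_hom_conj_i map_mat_conj_ext stable])
        (auto simp: complexJ(2)[OF h] adjoin_i_eq_iff)
    then show ?thesis by simp
  qed
  \<comment> \<open>If \<open>D a\<close> vanished at \<open>M\<close>, the minimal polynomial would divide it; but \<open>D a\<close> is \<open>1\<close> modulo the power at \<open>a\<close>.\<close>
  have spec_proj_nz: "spec_proj a \<noteq> 0\<^sub>m n n" if a: "a \<in> I" for a
  proof
    assume "spec_proj a = 0\<^sub>m n n"
    then have "ext_poly f dvd D a"
      using min_poly_dvd_ext[OF M min_poly] by (simp add: f_def)
    moreover have "q a dvd ext_poly f" unfolding ext_f using finI a by (rule dvd_prodI)
    ultimately have "q a dvd D a" by (metis dvd_trans)
    moreover have "q a dvd D a - 1" using C_local[OF a a] by (simp add: q_def)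
    ultimately have "q a dvd D a - (D a - 1)" by (rule dvd_diff)
    then have "q a dvd 1" by simp
    moreover have "[:- L a, 1:] dvd q a" using pos[OF a] by (simp add: q_def dvd_power)
    ultimately have "[:- L a, 1:] dvd 1" by (metis dvd_trans)
    then show False by (auto dest!: dvd_imp_degree_le)
  qed
  have S_formula: "ss_part M =
      mat_sum n (\<lambda>h. l h 1 \<cdot>\<^sub>m poly_mat (C h 1) (ext_mat M)
                   + conj_i (l h 1) \<cdot>\<^sub>m poly_mat (C h 2) (ext_mat M)) {1..s1}
      + mat_sum n (\<lambda>i. of_base (\<gamma> i) \<cdot>\<^sub>m poly_mat (C i 1) (ext_mat M)) {s1+1..s1+s2}
      - mat_sum n (\<lambda>i. of_base (\<gamma> i) \<cdot>\<^sub>m poly_mat (C i 1) (ext_mat M)) {s1+s2+1..r'}"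
  proof -
    have *: "mat_sum n (\<lambda>i. l i 1 \<cdot>\<^sub>m poly_mat (C i 1) (ext_mat M)) {s1+1..r'} =
        mat_sum n (\<lambda>i. of_base (\<gamma> i) \<cdot>\<^sub>m poly_mat (C i 1) (ext_mat M)) {s1+1..s1+s2}
      - mat_sum n (\<lambda>i. of_base (\<gamma> i) \<cdot>\<^sub>m poly_mat (C i 1) (ext_mat M)) {s1+s2+1..r'}"
      by (rule mat_sum_signs) (use E positive negative s_le in \<open>auto intro!: eq_matI simp: adjoin_i_eq_iff\<close>)
    show ?thesis
      unfolding ss by (subst calc_split) (simp, unfold *, auto intro!: eq_matI)
  qed
  have frob: "frobenius_decomposition n (ss_part M) J (\<lambda>(i, j). l i j)
      (\<lambda>(i, j). poly_mat (C i j) (ext_mat M))" if S0: "ss_part M \<noteq> 0\<^sub>m n n"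
  proof -
    have eqs: "(\<lambda>(i, j). l i j) = L" "(\<lambda>(i, j). poly_mat (C i j) (ext_mat M)) = spec_proj"
      by (auto simp: L_def)
    have S: "ss_part M = mat_sum n (\<lambda>a. L a \<cdot>\<^sub>m spec_proj a) J" unfolding ss by (rule calc_J) simp
    have "J \<noteq> {}" using S0 S by auto
    moreover have "finite J" by (simp add: J_def)
    moreover have "inj_on L J" using inj JI by (rule inj_on_subset)
    moreover have "\<forall>a\<in>J. \<forall>b\<in>J. spec_proj a * spec_proj b = (if a = b then spec_proj a else 0\<^sub>m n n)"
      using JI by (intro ballI spec_proj_mult) auto
    moreover have "\<forall>a\<in>J. spec_proj a \<in> carrier_mat n n \<and> spec_proj a \<noteq> 0\<^sub>m n n"
      using JI spec_proj_nz by (intro ballI conjI spec_proj_carrier) blast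
    moreover have "\<forall>a\<in>J. L a \<noteq> 0" using LJ_nz by blast
    ultimately show ?thesis
      unfolding frobenius_decomposition_def eqs using S by blast
  qed
  show ?thesis
  proof (intro conjI impI)
    assume S0: "ss_part M \<noteq> 0\<^sub>m n n"
    show "frobenius_decomposition n (ss_part M) ({1..s1} \<times> {1, 2} \<union> {s1+1..r'} \<times> {1})
        (\<lambda>(i, j). l i j) (\<lambda>(i, j). poly_mat (C i j) (ext_mat M))"
      using frob[OF S0] unfolding J_def .
  next
    show "\<forall>h\<in>{1..s1}. l h 1 \<notin> range of_base \<and>
        poly_mat (C h 2) (ext_mat M) = map_mat conj_i (poly_mat (C h 1) (ext_mat M))"
      using quadratic conjC by blast
  next
    assume inv: "invertible_mat M"
    have nz: "\<forall>a\<in>I. L a \<noteq> 0" using LJ_nz IJ inv by auto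
    note DSU = DSU_exists[OF K nz] DSU_eq[OF K nz]
    show "\<exists>!DSU. case DSU of (\<Delta>, \<Sigma>, U) \<Rightarrow> DSU_decomposition n M \<Delta> \<Sigma> U"
    proof (rule ex1I)
      show "case (real_calc (\<lambda>z. of_base (norm_K z)), real_calc (\<lambda>z. z / of_base (norm_K z)), real_calc inverse * M)
          of (\<Delta>, \<Sigma>, U) \<Rightarrow> DSU_decomposition n M \<Delta> \<Sigma> U"
        unfolding prod.case by (rule DSU(1))
      fix DSU :: "'a mat \<times> 'a mat \<times> 'a mat"
      assume "case DSU of (\<Delta>, \<Sigma>, U) \<Rightarrow> DSU_decomposition n M \<Delta> \<Sigma> U"
      then have "DSU_decomposition n M (fst DSU) (fst (snd DSU)) (snd (snd DSU))"
        by (simp add: split_def)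
      from DSU(2-4)[OF this] show "DSU = (real_calc (\<lambda>z. of_base (norm_K z)),
          real_calc (\<lambda>z. z / of_base (norm_K z)), real_calc inverse * M)"
        by (intro prod_eqI) (simp_all only: fst_conv snd_conv)
    qed
    show "\<forall>\<Delta> \<Sigma> U. DSU_decomposition n M \<Delta> \<Sigma> U \<longrightarrow>
            ext_mat \<Delta> =
                mat_sum n (\<lambda>h. of_base (norm_K (l h 1)) \<cdot>\<^sub>m
                    (poly_mat (C h 1) (ext_mat M) + poly_mat (C h 2) (ext_mat M))) {1..s1}
              + mat_sum n (\<lambda>i. of_base (\<gamma> i) \<cdot>\<^sub>m poly_mat (C i 1) (ext_mat M)) {s1+1..r'}
          \<and> ext_mat \<Sigma> =
                mat_sum n (\<lambda>h. (l h 1 / of_base (norm_K (l h 1))) \<cdot>\<^sub>m poly_mat (C h 1) (ext_mat M)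
                    + (conj_i (l h 1) / of_base (norm_K (l h 1))) \<cdot>\<^sub>m poly_mat (C h 2) (ext_mat M)) {1..s1}
              + mat_sum n (\<lambda>i. poly_mat (C i 1) (ext_mat M)) {s1+1..s1+s2}
              - mat_sum n (\<lambda>i. poly_mat (C i 1) (ext_mat M)) {s1+s2+1..r'}
          \<and> ss_part M = ext_mat \<Delta> * ext_mat \<Sigma>
          \<and> invertible_mat (ss_part M)
          \<and> ext_mat U = 1\<^sub>m n + the (mat_inverse (ss_part M)) * nil_part M
          \<and> (\<exists>p q u :: 'a poly. \<Delta> = poly_mat p M \<and> \<Sigma> = poly_mat q M \<and> U = poly_mat u M)"
    proof (intro allI impI conjI)
      fix \<Delta> \<Sigma> U :: "'a mat"
      assume dec: "DSU_decomposition n M \<Delta> \<Sigma> U"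
      note ext = DSU_unique[OF K nz dec]
      have mod\<gamma>: "norm_K (l i 1) = \<gamma> i" if "i \<in> {s1+1..r'}" for i
        using realJ(2,3)[OF that] by (auto simp: norm_K_of_base[OF K])
      show "ext_mat \<Delta> =
          mat_sum n (\<lambda>h. of_base (norm_K (l h 1)) \<cdot>\<^sub>m
              (poly_mat (C h 1) (ext_mat M) + poly_mat (C h 2) (ext_mat M))) {1..s1}
        + mat_sum n (\<lambda>i. of_base (\<gamma> i) \<cdot>\<^sub>m poly_mat (C i 1) (ext_mat M)) {s1+1..r'}"
      proof -
        have "mat_sum n (\<lambda>h. of_base (norm_K (l h 1)) \<cdot>\<^sub>m poly_mat (C h 1) (ext_mat M)
              + of_base (norm_K (conj_i (l h 1))) \<cdot>\<^sub>m poly_mat (C h 2) (ext_mat M)) {1..s1} =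
            mat_sum n (\<lambda>h. of_base (norm_K (l h 1)) \<cdot>\<^sub>m
              (poly_mat (C h 1) (ext_mat M) + poly_mat (C h 2) (ext_mat M))) {1..s1}"
          by (rule mat_sum_cong)
            (use E in \<open>simp add: norm_K_conj[OF K] add_smult_distrib_left_mat[of _ n n]\<close>)
        moreover have "mat_sum n (\<lambda>i. of_base (norm_K (l i 1)) \<cdot>\<^sub>m poly_mat (C i 1) (ext_mat M)) {s1+1..r'} =
            mat_sum n (\<lambda>i. of_base (\<gamma> i) \<cdot>\<^sub>m poly_mat (C i 1) (ext_mat M)) {s1+1..r'}"
          by (rule mat_sum_cong) (simp only: mod\<gamma>)
        ultimately show ?thesis
          unfolding ext(1) using calc_split[of "\<lambda>z. of_base (norm_K z)"] inv by metis
      qed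
      show "ext_mat \<Sigma> =
          mat_sum n (\<lambda>h. (l h 1 / of_base (norm_K (l h 1))) \<cdot>\<^sub>m poly_mat (C h 1) (ext_mat M)
              + (conj_i (l h 1) / of_base (norm_K (l h 1))) \<cdot>\<^sub>m poly_mat (C h 2) (ext_mat M)) {1..s1}
        + mat_sum n (\<lambda>i. poly_mat (C i 1) (ext_mat M)) {s1+1..s1+s2}
        - mat_sum n (\<lambda>i. poly_mat (C i 1) (ext_mat M)) {s1+s2+1..r'}"
      proof -
        have p1: "l i 1 / of_base (norm_K (l i 1)) = 1" if i: "i \<in> {s1+1..s1+s2}" for i
        proof -
          have "l i 1 = of_base (\<gamma> i)" "0 < \<gamma> i" using positive i by auto
          moreover have "of_base (\<gamma> i) \<noteq> 0" using \<open>0 < \<gamma> i\<close> by (simp add: adjoin_i_eq_iff)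
          ultimately show ?thesis using norm_K_of_base[OF K, of "\<gamma> i"] by simp
        qed
        have p2: "l i 1 / of_base (norm_K (l i 1)) = - 1" if i: "i \<in> {s1+s2+1..r'}" for i
        proof -
          have "l i 1 = of_base (- \<gamma> i)" "0 < \<gamma> i" using negative i by auto
          moreover have "of_base (- \<gamma> i) = - of_base (\<gamma> i)" by (simp add: adjoin_i_eq_iff)
          moreover have "of_base (\<gamma> i) \<noteq> 0" using \<open>0 < \<gamma> i\<close> by (simp add: adjoin_i_eq_iff)
          ultimately show ?thesis using norm_K_of_base[OF K, of "- \<gamma> i"] by simp
        qed
        have *: "mat_sum n (\<lambda>i. (l i 1 / of_base (norm_K (l i 1))) \<cdot>\<^sub>m poly_mat (C i 1) (ext_mat M)) {s1+1..r'} =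
            mat_sum n (\<lambda>i. poly_mat (C i 1) (ext_mat M)) {s1+1..s1+s2}
          - mat_sum n (\<lambda>i. poly_mat (C i 1) (ext_mat M)) {s1+s2+1..r'}"
        proof (rule mat_sum_signs)
          fix i assume "i \<in> {s1+1..s1+s2}"
          then show "(l i 1 / of_base (norm_K (l i 1))) \<cdot>\<^sub>m poly_mat (C i 1) (ext_mat M) =
              poly_mat (C i 1) (ext_mat M)" by (subst p1) (auto intro!: eq_matI)
        next
          fix i assume "i \<in> {s1+s2+1..r'}"
          then show "(l i 1 / of_base (norm_K (l i 1))) \<cdot>\<^sub>m poly_mat (C i 1) (ext_mat M) =
              - poly_mat (C i 1) (ext_mat M)" by (subst p2) (auto intro!: eq_matI)
        qed (use E s_le in auto)
        have "ext_mat \<Sigma> = mat_sum n (\<lambda>h. (l h 1 / of_base (norm_K (l h 1))) \<cdot>\<^sub>m poly_mat (C h 1) (ext_mat M)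
              + (conj_i (l h 1) / of_base (norm_K (l h 1))) \<cdot>\<^sub>m poly_mat (C h 2) (ext_mat M)) {1..s1}
            + mat_sum n (\<lambda>i. (l i 1 / of_base (norm_K (l i 1))) \<cdot>\<^sub>m poly_mat (C i 1) (ext_mat M)) {s1+1..r'}"
          unfolding ext(2) using calc_split[of "\<lambda>z. z / of_base (norm_K z)"] inv
          by (simp add: norm_K_conj[OF K])
        then show ?thesis unfolding * by (auto intro!: eq_matI)
      qed
      show "ss_part M = ext_mat \<Delta> * ext_mat \<Sigma>"
        unfolding ss ext(1,2) modulus_mult_phase[OF K nz] ..
      show "invertible_mat (ss_part M)"
        unfolding ss by (rule mat_inverse_calc[OF K nz])
      show "ext_mat U = 1\<^sub>m n + the (mat_inverse (ss_part M)) * nil_part M"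
        unfolding ss np mat_inverse_calc(2)[OF K nz] ext(3) by (simp add: inverse_mult_E[OF K nz])
      have "U = poly_mat (map_poly re_part (calc_poly inverse) * [:0, 1:]) M"
        unfolding DSU(4)[OF dec] poly_mat_mult[OF M] using M by (simp add: real_calc_def)
      then show "\<exists>p q u. \<Delta> = poly_mat p M \<and> \<Sigma> = poly_mat q M \<and> U = poly_mat u M"
        using DSU(2,3)[OF dec] unfolding real_calc_def by blast
    qed
  qed (use S_formula gamma_pos in auto)
qed

end
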